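(* Suppose $G_1, G_2, G_3, \dots$ is a family of (non-complete) $k$-regular $\varepsilon$-expander graphs, where $k \geq 3$ and $\varepsilon>0$. Let $H \neq K_n$ be a fixed connected $r$-regular graph on $n$ vertices such that $nk$ is even. For each $i \geq 1$, let $G_i(H)$ be any $(n+1)k$-regular graph obtained by adding $n(nk - r)n_i/2$ edges to $G_i \star H$, where $n_i = |V(G_i)|$. Then $G_1(H), G_2(H), G_3(H), \dots$ is a family of $\delta(n, k, \varepsilon)$-expander graphs of degree $(n+1)k$, where $$\delta(n,k,\varepsilon)=\frac12\min\{f_{n,k}(\varepsilon),\,f_{n,k}(2k)\},\qquad f_{n,k}(x) = x + (n+1)k - \sqrt{(4n+1)x^2 - 2(3n+1)kx + ((n+1)k)^2}.$$
   Context: All graphs are finite, undirected and simple. For a graph $G$, $L(G)$ is its Laplacian matrix (degree matrix minus adjacency matrix) with eigenvalues $0=\mu_1(G)\le\mu_2(G)\le\cdots$, and $a(G)=\mu_2(G)$ is its algebraic connectivity. For a fixed $\varepsilon>0$, an infinite family of graphs $G_1,G_2,\dots$ is a family of $\varepsilon$-expander graphs if (i) all of them are $k$-regular for a fixed integer $k\ge 3$, (ii) $a(G_i)\ge\varepsilon$ for all $i$, and (iii) $|V(G_i)|\to\infty$ as $i\to\infty$. $K_n$ is the complete graph on $n$ vertices. The neighbourhood corona $G_1\star G_2$ of graphs $G_1$ (with vertices $v_1,\dots,v_{n_1}$) and $G_2$ is the graph obtained by taking one copy of $G_1$ and $n_1$ copies of $G_2$, all vertex-disjoint, and joining every neighbour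 (in $G_1$) of $v_i$ to every vertex of the $i$th copy of $G_2$ by a new edge, for each $i$. In forming $G_i(H)$, added edges must keep the graph simple (a new edge may join two non-adjacent vertices of the same copy of $H$). *)

theory Defs
  imports "Jordan_Normal_Form.Char_Poly" "Graph_Theory.Graph_Theory"
begin

text \<open>
  An undirected simple graph is represented by a symmetric, loop-free, finite digraph: each
  edge $uv$ is the pair of arcs $(u,v)$, $(v,u)$. The library locale admits the graph without
  vertices, which is excluded here (it has no eigenvalue $\mu_1$).
\<close>
definition simple_graph :: "'a pair_pre_digraph \<Rightarrow> bool" where
  "simple_graph G \<longleftrightarrow> pair_graph G \<and> pverts G \<noteq> {}"

definition graph_edges :: "'a pair_pre_digraph \<Rightarrow> 'a set set" where
  "graph_edges G = {{u, v} | u v. (u, v) \<in> parcs G}"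

text \<open>The arcs leaving a vertex correspond to its incident edges.\<close>
definition regular_graph :: "nat \<Rightarrow> 'a pair_pre_digraph \<Rightarrow> bool" where
  "regular_graph k G \<longleftrightarrow> (\<forall>v \<in> pverts G. out_degree (with_proj G) v = k)"

definition complete_graph :: "'a pair_pre_digraph \<Rightarrow> bool" where
  "complete_graph G \<longleftrightarrow> complete_digraph (card (pverts G)) (with_proj G)"

definition degree_matrix :: "'a pair_pre_digraph \<Rightarrow> 'a list \<Rightarrow> real mat" where
  "degree_matrix G vs = mat (length vs) (length vs)
     (\<lambda>(i, j). if i = j then real (out_degree (with_proj G) (vs ! i)) else 0)"

definition adjacency_matrix :: "'a pair_pre_digraph \<Rightarrow> 'a list \<Rightarrow> real mat" where
  "adjacency_matrix G vs = mat (length vs) (length vs)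
     (\<lambda>(i, j). if (vs ! i, vs ! j) \<in> parcs G then 1 else 0)"

text \<open>The list \<open>vs\<close> enumerates the vertices, in the order in which they index the matrix.\<close>
definition laplacian :: "'a pair_pre_digraph \<Rightarrow> 'a list \<Rightarrow> real mat" where
  "laplacian G vs = degree_matrix G vs - adjacency_matrix G vs"

lemma laplacian_index:
  assumes "i < length vs" "j < length vs"
  shows "laplacian G vs $$ (i, j) =
    (if i = j then real (out_degree (with_proj G) (vs ! i)) else 0)
    - (if (vs ! i, vs ! j) \<in> parcs G then 1 else 0)"
  using assms by (simp add: laplacian_def degree_matrix_def adjacency_matrix_def)

text \<open>The spectrum does not depend on the enumeration of the vertices.\<close>
lemma char_poly_laplacian_order:
  assumes "distinct vs" "distinct ws" "set vs = set ws"
  shows "char_poly (laplacian G vs) = char_poly (laplacian G ws)"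
proof -
  define n where "n = length vs"
  have lw: "length ws = n"
    using assms by (metis distinct_card n_def)
  have dv: "laplacian G vs \<in> carrier_mat n n" and dw: "laplacian G ws \<in> carrier_mat n n"
    by (auto simp: laplacian_def degree_matrix_def adjacency_matrix_def n_def lw)
  define p where "p i = (THE j. j < n \<and> vs ! j = ws ! i)" for i
  define q where "q i = (THE j. j < n \<and> ws ! j = vs ! i)" for i
  have p: "p i < n \<and> vs ! p i = ws ! i" if "i < n" for i
  proof -
    have "\<exists>!j. j < n \<and> vs ! j = ws ! i"
      using that assms lw n_def
      by (metis distinct_Ex1 nth_mem)
    then show ?thesis unfolding p_def by (rule theI')
  qed
  have q: "q i < n \<and> ws ! q i = vs ! i" if "i < n" for i
  proof -
    have "\<exists>!j. j < n \<and> ws ! j = vs ! i"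
      using that assms lw n_def
      by (metis distinct_Ex1 nth_mem)
    then show ?thesis unfolding q_def by (rule theI')
  qed
  have pq: "p (q i) = i" "q (p i) = i" if "i < n" for i
    using p q that assms lw n_def nth_eq_iff_index_eq by metis+
  have peq: "p i = p j \<longleftrightarrow> i = j" if "i < n" "j < n" for i j
    using pq that by metis
  define P :: "real mat" where "P = mat n n (\<lambda>(i, j). if j = p i then 1 else 0)"
  define Q :: "real mat" where "Q = mat n n (\<lambda>(i, j). if i = p j then 1 else 0)"
  have PQ: "P * Q = 1\<^sub>m n"
  proof (rule eq_matI)
    fix i j assume "i < dim_row (1\<^sub>m n :: real mat)" "j < dim_col (1\<^sub>m n :: real mat)"
    then have ij: "i < n" "j < n" by auto
    have "(P * Q) $$ (i, j)
      = (\<Sum>l = 0..<n. (if l = p i then 1 else 0) * (if l = p j then 1 else 0))"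
      using ij by (simp add: P_def Q_def scalar_prod_def)
    also have "\<dots> = (\<Sum>l = 0..<n. if l = p i then (if p i = p j then 1 else 0) else 0)"
      by (rule sum.cong) auto
    also have "\<dots> = (if p i = p j then 1 else 0)"
      using p[OF ij(1)] by simp
    finally show "(P * Q) $$ (i, j) = 1\<^sub>m n $$ (i, j)"
      using ij peq by simp
  qed (auto simp: P_def Q_def)
  have QP: "Q * P = 1\<^sub>m n"
    by (rule mat_mult_left_right_inverse[OF _ _ PQ]) (auto simp: P_def Q_def)
  have sim: "laplacian G ws = P * laplacian G vs * Q"
  proof (rule eq_matI)
    fix i j assume "i < dim_row (P * laplacian G vs * Q)" "j < dim_col (P * laplacian G vs * Q)"
    then have ij: "i < n" "j < n" by (auto simp: P_def Q_def)
    have PL: "(P * laplacian G vs) $$ (i, k) = laplacian G vs $$ (p i, k)" if "k < n" for k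
    proof -
      have "(P * laplacian G vs) $$ (i, k)
        = (\<Sum>l = 0..<n. (if l = p i then 1 else 0) * laplacian G vs $$ (l, k))"
        using ij that dv by (auto simp: P_def scalar_prod_def intro!: sum.cong)
      also have "\<dots> = laplacian G vs $$ (p i, k)"
        using p[OF ij(1)] by (simp add: if_distrib[of "\<lambda>x. x * _"] cong: if_cong)
      finally show ?thesis .
    qed
    have "(P * laplacian G vs * Q) $$ (i, j)
      = (\<Sum>k = 0..<n. (P * laplacian G vs) $$ (i, k) * (if k = p j then 1 else 0))"
      using ij dv by (auto simp: P_def Q_def scalar_prod_def intro!: sum.cong)
    also have "\<dots> = (P * laplacian G vs) $$ (i, p j)"
      using p[OF ij(2)] by (simp add: if_distrib cong: if_cong)
    also have "\<dots> = laplacian G vs $$ (p i, p j)"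
      using PL p ij by blast
    finally show "laplacian G ws $$ (i, j) = (P * laplacian G vs * Q) $$ (i, j)"
      using ij p lw n_def peq by (simp add: laplacian_index)
  qed (use dw in \<open>auto simp: P_def Q_def\<close>)
  have "similar_mat (laplacian G ws) (laplacian G vs)"
    by (rule similar_matI[where P = P and Q = Q and n = n])
       (use dv dw PQ QP sim in \<open>auto simp: P_def Q_def\<close>)
  then show ?thesis by (simp add: char_poly_similar)
qed

text \<open>The eigenvalues $\mu_1 \le \mu_2 \le \dots$, each repeated according to its multiplicity.\<close>
definition laplacian_spectrum :: "'a pair_pre_digraph \<Rightarrow> real list" where
  "laplacian_spectrum G = sorted_list_of_multiset (proots (char_poly
     (laplacian G (SOME vs. distinct vs \<and> set vs = pverts G))))"

text \<open>Lists are indexed from 0, so this is $\mu_2$. It is only meaningful for graphs with at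
  least two vertices, in particular for regular graphs of positive degree.\<close>
definition algebraic_connectivity :: "'a pair_pre_digraph \<Rightarrow> real" where
  "algebraic_connectivity G = laplacian_spectrum G ! 1"

definition expander_family :: "nat \<Rightarrow> real \<Rightarrow> (nat \<Rightarrow> 'a pair_pre_digraph) \<Rightarrow> bool" where
  "expander_family k \<epsilon> G \<longleftrightarrow>
     3 \<le> k \<and> 0 < \<epsilon> \<and>
     (\<forall>i. simple_graph (G i) \<and> regular_graph k (G i) \<and> \<epsilon> \<le> algebraic_connectivity (G i)) \<and>
     filterlim (\<lambda>i. card (pverts (G i))) at_top sequentially"

text \<open>\<open>Inl v\<close> is the vertex \<open>v\<close> of \<open>G\<close>; \<open>Inr (v, x)\<close> is the vertex \<open>x\<close> in the
  copy of \<open>H\<close> belonging to \<open>v\<close>.\<close>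
definition neighbourhood_corona ::
    "'a pair_pre_digraph \<Rightarrow> 'b pair_pre_digraph \<Rightarrow> ('a + 'a \<times> 'b) pair_pre_digraph"
    (infixl "\<star>" 70) where
  "G \<star> H = \<lparr> pverts = pverts G <+> (pverts G \<times> pverts H),
     parcs = {(Inl u, Inl v) | u v. (u, v) \<in> parcs G}
       \<union> {(Inr (v, x), Inr (v, y)) | v x y. v \<in> pverts G \<and> (x, y) \<in> parcs H}
       \<union> {(Inl u, Inr (v, x)) | u v x. (v, u) \<in> parcs G \<and> x \<in> pverts H}
       \<union> {(Inr (v, x), Inl u) | u v x. (v, u) \<in> parcs G \<and> x \<in> pverts H} \<rparr>"

text \<open>The number \<open>m\<close> of added edges is a real number, so that it can be given by an expression
  with differences and halves that are not truncated.\<close>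
definition adds_edges :: "real \<Rightarrow> 'a pair_pre_digraph \<Rightarrow> 'a pair_pre_digraph \<Rightarrow> bool" where
  "adds_edges m G G' \<longleftrightarrow> simple_graph G' \<and> pverts G' = pverts G \<and>
     graph_edges G \<subseteq> graph_edges G' \<and> real (card (graph_edges G' - graph_edges G)) = m"

definition f_fun :: "nat \<Rightarrow> nat \<Rightarrow> real \<Rightarrow> real" where
  "f_fun n k x = x + (real n + 1) * real k
     - sqrt ((4 * real n + 1) * x\<^sup>2 - 2 * (3 * real n + 1) * real k * x
         + ((real n + 1) * real k)\<^sup>2)"

definition delta :: "nat \<Rightarrow> nat \<Rightarrow> real \<Rightarrow> real" where
  "delta n k \<epsilon> = 1 / 2 * min (f_fun n k \<epsilon>) (f_fun n k (2 * real k))"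

end

theory Submission
  imports Defs "Jordan_Normal_Form.Spectral_Radius"
begin

text \<open>
  Let $L$ be the Laplacian of a \<open>k\<close>-regular graph \<open>G\<close> and let \<open>y\<close> be a function on the vertices
  of \<open>G \<star> H\<close> whose restriction $a$ to \<open>G\<close> has sum 0. Dropping the edges inside the copies of \<open>H\<close>
  and the added edges, and minimising over the values on the copies, the inequality
  $\langle y, L(G_i(H)) y \rangle \ge \delta |y|^2$ reduces to $\langle a, p(L) a \rangle \ge 0$, where
  $p(x) = nk + x - \delta - n (k - x)^2 / (k - \delta)$. The polynomial $p$ is concave and
  nonnegative at $\varepsilon$ and $2k$ by the choice of $\delta$, so it is a nonnegative combination
  of $x - \varepsilon$, $2k - x$ and $(x - \varepsilon)(2k - x)$. All three are positive semidefinite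
  at $L$ on the functions with sum 0; for the product $BC$ of $B = L - \varepsilon$ and $C = 2k - L$
  this follows from $(B + C) B C = B C B + C B C$ and $B + C = 2k - \varepsilon > 0$.
\<close>

section \<open>The spectrum of a real symmetric matrix\<close>

lemma scalar_prod_self_nonneg: "0 \<le> v \<bullet> (v :: real vec)"
  by (simp add: scalar_prod_def sum_nonneg)

lemma scalar_prod_self_eq_0_iff:
  fixes v :: "real vec"
  assumes "v \<in> carrier_vec n"
  shows "v \<bullet> v = 0 \<longleftrightarrow> v = 0\<^sub>v n"
proof -
  have "v \<bullet> v = 0 \<longleftrightarrow> (\<forall>i<n. v $ i = 0)"
    using assms by (auto simp: scalar_prod_def sum_nonneg_eq_0_iff)
  also have "\<dots> \<longleftrightarrow> v = 0\<^sub>v n"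
    using assms by auto
  finally show ?thesis .
qed

lemma symmetric_scalar_prod:
  fixes A :: "'a :: comm_semiring_0 mat"
  assumes "A \<in> carrier_mat n n" "A\<^sup>T = A" "x \<in> carrier_vec n" "y \<in> carrier_vec n"
  shows "(A *\<^sub>v y) \<bullet> x = y \<bullet> (A *\<^sub>v x)"
  using transpose_vec_mult_scalar[OF assms(1,3,4)] assms(2) by simp

text \<open>Over the complex numbers an eigenvector \<open>w\<close> always exists. Symmetry forces
  its eigenvalue to be real, so the real and imaginary parts of \<open>w\<close> both satisfy the
  real eigenvalue equation, and a nonzero one of them can be normalized.\<close>

lemma real_symmetric_unit_eigenvector:
  fixes A :: "real mat"
  assumes A: "A \<in> carrier_mat n n" and sym: "A\<^sup>T = A" and n: "0 < n"
  obtains v e where "v \<in> carrier_vec n" "v \<bullet> v = 1" "A *\<^sub>v v = e \<cdot>\<^sub>v v"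
proof -
  let ?C = "map_mat complex_of_real A"
  have C: "?C \<in> carrier_mat n n" using A by simp
  obtain z w where w: "w \<in> carrier_vec n" "w \<noteq> 0\<^sub>v n" "?C *\<^sub>v w = z \<cdot>\<^sub>v w"
    using spectrum_non_empty[OF C n] C
    by (auto simp: spectrum_def eigenvalue_def eigenvector_def)
  define x where "x = map_vec Re w"
  define y where "y = map_vec Im w"
  have xy: "x \<in> carrier_vec n" "y \<in> carrier_vec n"
    using w by (auto simp: x_def y_def)
  have comp: "(\<Sum>j = 0..<n. complex_of_real (A $$ (i, j)) * w $ j) = z * w $ i" if "i < n" for i
  proof -
    have "(?C *\<^sub>v w) $ i = (z \<cdot>\<^sub>v w) $ i" using w by simp
    then show ?thesis using that A w(1) by (simp add: scalar_prod_def)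
  qed
  have Ax: "A *\<^sub>v x = Re z \<cdot>\<^sub>v x - Im z \<cdot>\<^sub>v y"
  proof (rule eq_vecI)
    fix i assume "i < dim_vec (Re z \<cdot>\<^sub>v x - Im z \<cdot>\<^sub>v y)"
    then have i: "i < n" using xy by simp
    have "Re (\<Sum>j = 0..<n. complex_of_real (A $$ (i, j)) * w $ j) = Re (z * w $ i)"
      using comp[OF i] by simp
    then show "(A *\<^sub>v x) $ i = (Re z \<cdot>\<^sub>v x - Im z \<cdot>\<^sub>v y) $ i"
      using i A w by (simp add: scalar_prod_def x_def y_def)
  qed (use A xy in auto)
  have Ay: "A *\<^sub>v y = Im z \<cdot>\<^sub>v x + Re z \<cdot>\<^sub>v y"
  proof (rule eq_vecI)
    fix i assume "i < dim_vec (Im z \<cdot>\<^sub>v x + Re z \<cdot>\<^sub>v y)"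
    then have i: "i < n" using xy by simp
    have "Im (\<Sum>j = 0..<n. complex_of_real (A $$ (i, j)) * w $ j) = Im (z * w $ i)"
      using comp[OF i] by simp
    then show "(A *\<^sub>v y) $ i = (Im z \<cdot>\<^sub>v x + Re z \<cdot>\<^sub>v y) $ i"
      using i A w by (simp add: scalar_prod_def x_def y_def)
  qed (use A xy in auto)
  \<comment> \<open>After both sides are expanded, the terms with \<open>Re z\<close> cancel and
    \<open>Im z\<close> times the squared norm of \<open>w\<close> remains.\<close>
  have "(A *\<^sub>v x) \<bullet> y = x \<bullet> (A *\<^sub>v y)"
    using symmetric_scalar_prod[OF A sym xy(2,1)] .
  then have "Im z * (x \<bullet> x + y \<bullet> y) = 0"
    using xy comm_scalar_prod[OF xy(2,1)]
    by (simp add: Ax Ay scalar_prod_add_distrib[of _ n] minus_scalar_prod_distrib[of _ n]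
        algebra_simps)
  moreover have nz: "x \<noteq> 0\<^sub>v n \<or> y \<noteq> 0\<^sub>v n"
  proof (rule ccontr)
    assume "\<not> ?thesis"
    then have *: "x = 0\<^sub>v n" "y = 0\<^sub>v n" by auto
    have "w = 0\<^sub>v n"
    proof (rule eq_vecI)
      fix i assume "i < dim_vec (0\<^sub>v n :: complex vec)"
      then have i: "i < n" by simp
      have "x $ i = 0" "y $ i = 0" using * i by auto
      then show "w $ i = 0\<^sub>v n $ i" using i w by (simp add: x_def y_def complex_eq_iff)
    qed (use w in auto)
    with w show False by simp
  qed
  then have "x \<bullet> x + y \<bullet> y \<noteq> 0"
    using xy scalar_prod_self_nonneg[of x] scalar_prod_self_nonneg[of y]
    by (auto simp: add_nonneg_eq_0_iff scalar_prod_self_eq_0_iff)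
  ultimately have im: "Im z = 0" by simp
  have "A *\<^sub>v x = Re z \<cdot>\<^sub>v x" "A *\<^sub>v y = Re z \<cdot>\<^sub>v y"
    using xy by (auto simp: Ax Ay im)
  then obtain u where u: "u \<in> carrier_vec n" "u \<noteq> 0\<^sub>v n" "A *\<^sub>v u = Re z \<cdot>\<^sub>v u"
    using nz xy by blast
  have pos: "0 < u \<bullet> u"
    using u scalar_prod_self_nonneg[of u] scalar_prod_self_eq_0_iff[OF u(1)] by linarith
  define c where "c = 1 / sqrt (u \<bullet> u)"
  have c: "c * c * (u \<bullet> u) = 1" using pos by (simp add: c_def)
  show ?thesis
  proof
    show "c \<cdot>\<^sub>v u \<in> carrier_vec n" using u by simp
    show "(c \<cdot>\<^sub>v u) \<bullet> (c \<cdot>\<^sub>v u) = 1" using c u by (simp add: mult.assoc)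
    show "A *\<^sub>v (c \<cdot>\<^sub>v u) = Re z \<cdot>\<^sub>v (c \<cdot>\<^sub>v u)"
      using u A by (simp add: smult_smult_assoc mult.commute mult_mat_vec)
  qed
qed

lemma orthogonal_mat_first_column:
  fixes v :: "real vec"
  assumes v: "v \<in> carrier_vec n" "v \<bullet> v = 1" and n: "0 < n"
  obtains P where "P \<in> carrier_mat n n" "P\<^sup>T * P = 1\<^sub>m n" "col P 0 = v"
proof (cases "v = unit_vec n 0")
  case True
  show ?thesis
    by (rule that[of "1\<^sub>m n"]) (use n True in auto)
next
  case False
  txt \<open>\<open>P\<close> below is the Householder reflection that exchanges \<open>v\<close> and the first unit vector.\<close>
  define w where "w = v - unit_vec n 0"
  have w: "w \<in> carrier_vec n" using v by (simp add: w_def)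
  \<comment> \<open>As \<open>v\<close> and the first unit vector both have norm 1, this gives
    \<open>c * w $ 0 = -1\<close> below, so column 0 of \<open>P\<close> is the first unit vector
    plus \<open>w\<close>, that is \<open>v\<close>.\<close>
  have ww: "w \<bullet> w = - 2 * w $ 0"
  proof -
    have "w \<bullet> w = v \<bullet> v - 2 * v $ 0 + 1"
      using v n by (simp add: w_def scalar_prod_minus_distrib[of _ n] 
          minus_scalar_prod_distrib[of _ n])
    then show ?thesis using v n by (simp add: w_def)
  qed
  have "w \<noteq> 0\<^sub>v n"
  proof
    assume "w = 0\<^sub>v n"
    then have "w $ i = 0" if "i < n" for i
      using that by simp
    then have "v $ i = unit_vec n 0 $ i" if "i < n" for i
      using that v by (simp add: w_def)
    then have "v = unit_vec n 0" using v by auto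
    with False show False by simp
  qed
  then have w0: "w \<bullet> w \<noteq> 0" using scalar_prod_self_eq_0_iff[OF w] by simp
  define c where "c = 2 / (w \<bullet> w)"
  have c: "c * (w \<bullet> w) = 2" using w0 by (simp add: c_def)
  define P where "P = mat n n (\<lambda>(i, j). (if i = j then 1 else 0) - c * (w $ i * w $ j))"
  show ?thesis
  proof
    show P: "P \<in> carrier_mat n n" by (simp add: P_def)
    show "P\<^sup>T * P = 1\<^sub>m n"
    proof (rule eq_matI)
      fix i j assume "i < dim_row (1\<^sub>m n :: real mat)" "j < dim_col (1\<^sub>m n :: real mat)"
      then have ij: "i < n" "j < n" by auto
      let ?e = "\<lambda>i j. if i = j then 1 else 0 :: real"
      have e: "(\<Sum>l = 0..<n. ?e l m * g l) = g m" if "m < n" for m g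
        using that by (simp add: if_distrib[of "\<lambda>x. x * _"] cong: if_cong)
      have "(P\<^sup>T * P) $$ (i, j) =
        (\<Sum>l = 0..<n. (?e l i - c * (w $ l * w $ i)) * (?e l j - c * (w $ l * w $ j)))"
        using ij by (simp add: P_def scalar_prod_def)
      also have "\<dots> = (\<Sum>l = 0..<n. ?e l i * ?e l j - ?e l i * (c * (w $ l * w $ j))
          - ?e l j * (c * (w $ l * w $ i)) + c * c * w $ i * w $ j * (w $ l * w $ l))"
        by (rule sum.cong) (simp_all add: algebra_simps)
      also have "\<dots> = ?e i j - c * (w $ i * w $ j) - c * (w $ j * w $ i)
          + c * c * w $ i * w $ j * (w \<bullet> w)"
        using ij w by (simp only: sum.distrib sum_subtractf e)
          (simp add: scalar_prod_def sum_distrib_left)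
      also have "\<dots> = ?e i j - 2 * c * (w $ i * w $ j) + c * w $ i * w $ j * (c * (w \<bullet> w))"
        by (simp add: algebra_simps)
      also have "\<dots> = ?e i j" by (simp add: c)
      finally show "(P\<^sup>T * P) $$ (i, j) = 1\<^sub>m n $$ (i, j)" using ij by simp
    qed (use P in auto)
    show "col P 0 = v"
    proof (rule eq_vecI)
      fix i assume "i < dim_vec v"
      then have i: "i < n" using v by simp
      have "c * w $ 0 = -1" using c ww by simp
      then have "c * (w $ i * w $ 0) = - w $ i"
        by (metis mult.left_commute mult.right_neutral mult_minus_right)
      then show "col P 0 $ i = v $ i" using i n v by (simp add: P_def w_def)
    qed (use P v in auto)
  qed
qed


text \<open>Deflation: conjugation by an orthogonal matrix whose first column is a unit eigenvector
  clears the first column off the corner, and by symmetry also the first row. The induction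
  hypothesis diagonalizes the remaining symmetric block.\<close>

theorem real_symmetric_diagonalization:
  fixes A :: "real mat"
  assumes "A \<in> carrier_mat n n" "A\<^sup>T = A"
  obtains P d where "P \<in> carrier_mat n n" "P\<^sup>T * P = 1\<^sub>m n" "A = P * mat_diag n d * P\<^sup>T"
  using assms
proof (induction n arbitrary: A thesis)
  case 0
  show ?case
    by (rule "0.prems"(1)[of "1\<^sub>m 0" "\<lambda>_. 0"]) (use 0 in auto)
next
  case (Suc n)
  note A = Suc.prems(2,3)
  obtain v e where v: "v \<in> carrier_vec (Suc n)" "v \<bullet> v = 1" and Av: "A *\<^sub>v v = e \<cdot>\<^sub>v v"
    using real_symmetric_unit_eigenvector[OF A] by blast
  obtain P where P: "P \<in> carrier_mat (Suc n) (Suc n)" "P\<^sup>T * P = 1\<^sub>m (Suc n)" "col P 0 = v"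
    using orthogonal_mat_first_column[OF v] by blast
  have PT: "P\<^sup>T \<in> carrier_mat (Suc n) (Suc n)" using P by simp
  have PPT: "P * P\<^sup>T = 1\<^sub>m (Suc n)"
    using mat_mult_left_right_inverse[OF PT P(1,2)] .
  define B where "B = P\<^sup>T * (A * P)"
  have B: "B \<in> carrier_mat (Suc n) (Suc n)" using P A by (simp add: B_def)
  have B_sym: "B\<^sup>T = B"
    using P A by (simp add: B_def transpose_mult[of _ "Suc n" "Suc n" _ "Suc n"]
        assoc_mult_mat[of _ "Suc n" "Suc n" _ "Suc n" _ "Suc n"])
  have B_col: "B $$ (i, 0) = (if i = 0 then e else 0)" if i: "i < Suc n" for i
  proof -
    have "B $$ (i, 0) = col P i \<bullet> (A *\<^sub>v v)"
      using i P A col_mult2[OF A(1) P(1), of 0] by (simp add: B_def del: col_mult)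
    also have "\<dots> = e * (col P i \<bullet> col P 0)"
      using P v i by (simp add: Av)
    also have "col P i \<bullet> col P 0 = (P\<^sup>T * P) $$ (i, 0)"
      using i P(1) by simp
    also have "\<dots> = (if i = 0 then 1 else 0)"
      using i by (simp add: P(2))
    finally show ?thesis by simp
  qed
  have B_row: "B $$ (0, i) = (if i = 0 then e else 0)" if i: "i < Suc n" for i
  proof -
    have "B $$ (0, i) = B\<^sup>T $$ (i, 0)" using B i by simp
    then show ?thesis using B_col[OF i] B_sym by simp
  qed
  define B' where "B' = mat n n (\<lambda>(i, j). B $$ (Suc i, Suc j))"
  have B': "B' \<in> carrier_mat n n" by (simp add: B'_def)
  have "B'\<^sup>T = B'"
  proof (rule eq_matI)
    fix i j assume "i < dim_row B'" "j < dim_col B'"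
    then have ij: "i < n" "j < n" using B' by auto
    have "B $$ (Suc j, Suc i) = B\<^sup>T $$ (Suc i, Suc j)" using B ij by simp
    then show "B'\<^sup>T $$ (i, j) = B' $$ (i, j)" using ij by (simp add: B'_def B_sym)
  qed (use B' in auto)
  then obtain Q d where Q: "Q \<in> carrier_mat n n" "Q\<^sup>T * Q = 1\<^sub>m n"
    and B'_eq: "B' = Q * mat_diag n d * Q\<^sup>T"
    using Suc.IH[OF _ B'] by blast
  \<comment> \<open>\<open>R\<close> lets \<open>Q\<close> act on the last \<open>n\<close>
    coordinates and fixes the first, so that \<open>P * R\<close> diagonalizes
    \<open>A\<close>.\<close>
  define R where "R = four_block_mat (1\<^sub>m 1) (0\<^sub>m 1 n) (0\<^sub>m n 1) Q"
  have R: "R \<in> carrier_mat (Suc n) (Suc n)" 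
    unfolding R_def using four_block_carrier_mat[of "1\<^sub>m 1" 1 1 Q n n] Q by simp
  have RT: "R\<^sup>T = four_block_mat (1\<^sub>m 1) (0\<^sub>m 1 n) (0\<^sub>m n 1) Q\<^sup>T"
    using Q by (simp add: R_def transpose_four_block_mat[of _ 1 1 _ n _ n] del: One_nat_def)
  have RTR: "R\<^sup>T * R = 1\<^sub>m (Suc n)"
    unfolding RT unfolding R_def
    using Q four_block_one_mat[of 1 n]
    by (simp add: mult_four_block_mat[of _ 1 1 _ n _ n _ _ 1 _ n] plus_1_eq_Suc
        del: One_nat_def)
  define d' where "d' = case_nat e d"
  have D: "mat_diag (Suc n) d' = four_block_mat (mat_diag 1 (\<lambda>_. e)) (0\<^sub>m 1 n) (0\<^sub>m n 1) (mat_diag n d)"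
    by (rule eq_matI) (auto simp: mat_diag_def d'_def split: nat.split)
  have "B = four_block_mat (mat_diag 1 (\<lambda>_. e)) (0\<^sub>m 1 n) (0\<^sub>m n 1) B'"
    using B B_col B_row
    by (intro eq_matI) (auto simp: B'_def mat_diag_def)
  also have "\<dots> = R * mat_diag (Suc n) d' * R\<^sup>T"
  proof -
    define E where "E = mat_diag 1 (\<lambda>_. e)"
    define F where "F = mat_diag n d"
    have "E \<in> carrier_mat 1 1" "F \<in> carrier_mat n n" by (simp_all add: E_def F_def)
    then show ?thesis
      unfolding D RT E_def[symmetric] F_def[symmetric] B'_eq unfolding R_def
      using Q(1) by (simp add: mult_four_block_mat[of _ 1 1 _ n _ n _ _ 1 _ n] del: One_nat_def)
  qed
  finally have B_eq: "B = R * mat_diag (Suc n) d' * R\<^sup>T" .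
  note assoc = assoc_mult_mat[of _ "Suc n" "Suc n" _ "Suc n" _ "Suc n"]
  show ?case
  proof (rule Suc.prems(1))
    show "P * R \<in> carrier_mat (Suc n) (Suc n)" using P R by simp
    have "(P * R)\<^sup>T * (P * R) = R\<^sup>T * (P\<^sup>T * P) * R"
      using P(1) R by (simp add: transpose_mult[of _ "Suc n" "Suc n" _ "Suc n"] assoc)
    then show "(P * R)\<^sup>T * (P * R) = 1\<^sub>m (Suc n)" using R by (simp add: P(2) RTR)
    define F where "F = mat_diag (Suc n) d'"
    have F: "F \<in> carrier_mat (Suc n) (Suc n)" by (simp add: F_def)
    have "A = (P * P\<^sup>T) * A * (P * P\<^sup>T)" using A by (simp add: PPT)
    also have "\<dots> = P * B * P\<^sup>T" using A P(1) by (simp add: B_def assoc)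
    also have "\<dots> = P * R * mat_diag (Suc n) d' * (P * R)\<^sup>T"
      using P(1) R F unfolding B_eq F_def[symmetric] by (simp add: transpose_mult[of _ "Suc n" "Suc n" _ "Suc n"] assoc)
    finally show "A = P * R * mat_diag (Suc n) d' * (P * R)\<^sup>T" .
  qed
qed


text \<open>By similarity the characteristic polynomial is a product of linear factors, one for each
  diagonal entry. Multiplicities are kept, the order is not.\<close>

lemma proots_char_poly_diagonalization:
  fixes A :: "'a :: field mat"
  assumes "P \<in> carrier_mat n n" "Q \<in> carrier_mat n n" "Q * P = 1\<^sub>m n" "A = P * mat_diag n d * Q"
  shows "proots (char_poly A) = mset (map d [0..<n])"
proof -
  have "P * Q = 1\<^sub>m n"
    using mat_mult_left_right_inverse[OF assms(2,1,3)] .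
  then have "similar_mat A (mat_diag n d)"
    using assms by (intro similar_matI[of _ _ P Q n]) auto
  then have "char_poly A = char_poly (mat_diag n d)"
    by (rule char_poly_similar)
  also have "\<dots> = (\<Prod>a\<leftarrow>diag_mat (mat_diag n d). [:- a, 1:])"
    by (rule char_poly_upper_triangular[of _ n]) (auto simp: mat_diag_def)
  also have "diag_mat (mat_diag n d) = map d [0..<n]"
    by (auto simp: diag_mat_def mat_diag_def)
  also have "(\<Prod>a\<leftarrow>map d [0..<n]. [:- a, 1:]) = (\<Prod>p\<leftarrow>map (\<lambda>i. [:- d i, 1:]) [0..<n]. p)"
    by (simp add: comp_def)
  finally have "proots (char_poly A) = (\<Sum>p\<leftarrow>map (\<lambda>i. [:- d i, 1:]) [0..<n]. proots p)"
    by (simp only:) (rule proots_prod_list, auto)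
  also have "\<dots> = mset (map d [0..<n])"
    by (induction n) auto
  finally show ?thesis .
qed

text \<open>The construction of \<open>laplacian_spectrum\<close> for an arbitrary matrix, so that
  the spectral arguments can be made without a graph.\<close>

definition real_spectrum :: "real mat \<Rightarrow> real list" where
  "real_spectrum A = sorted_list_of_multiset (proots (char_poly A))"

text \<open>The sorted spectrum is a permutation of the diagonal of any diagonalization. Applying
  the same permutation \<open>f\<close> to the columns of \<open>P\<close> keeps it orthogonal and
  puts the eigenvalues in order.\<close>

theorem real_symmetric_sorted_diagonalization:
  fixes A :: "real mat"
  assumes A: "A \<in> carrier_mat n n" and sym: "A\<^sup>T = A"
  obtains P where "P \<in> carrier_mat n n" "P\<^sup>T * P = 1\<^sub>m n" "length (real_spectrum A) = n"
    "A = P * mat_diag n (nth (real_spectrum A)) * P\<^sup>T"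
proof -
  obtain P d where P: "P \<in> carrier_mat n n" "P\<^sup>T * P = 1\<^sub>m n" and A_eq: "A = P * mat_diag n d * P\<^sup>T"
    using real_symmetric_diagonalization[OF A sym] by blast
  have "proots (char_poly A) = mset (map d [0..<n])"
    using P A_eq by (intro proots_char_poly_diagonalization[of P n "P\<^sup>T"]) auto
  then have mset: "mset (real_spectrum A) = mset (map d [0..<n])"
    by (simp add: real_spectrum_def)
  then have len: "length (real_spectrum A) = n"
    by (metis mset_eq_length length_map length_upt diff_zero)
  obtain f where f_perm: "f permutes {..<n}" and f_eq: "permute_list f (map d [0..<n]) = real_spectrum A"
    using mset_eq_permutation[OF mset] by auto
  have f: "bij_betw f {..<n} {..<n}"
    using f_perm by (rule permutes_imp_bij)
  have nth: "real_spectrum A ! i = map d [0..<n] ! f i" if "i < n" for i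
    using permute_list_nth[of f "map d [0..<n]" i] f_perm f_eq that by simp
  have f_less: "f i < n" if "i < n" for i
    using f that by (auto simp: bij_betw_def)
  have f_inj: "f i = f j \<longleftrightarrow> i = j" if "i < n" "j < n" for i j
    using f that by (auto simp: bij_betw_def inj_on_def)
  have entry: "(X * mat_diag n g * X\<^sup>T) $$ (i, j) = (\<Sum>l<n. X $$ (i, l) * g l * X $$ (j, l))"
    if "X \<in> carrier_mat n n" "i < n" "j < n" for X :: "real mat" and g i j
    using that by (simp add: mat_diag_mult_right[of _ n] scalar_prod_def atLeast0LessThan)
  define Q where "Q = mat n n (\<lambda>(i, j). P $$ (i, f j))"
  have Q: "Q \<in> carrier_mat n n" by (simp add: Q_def)
  show ?thesis
  proof
    show "Q \<in> carrier_mat n n" by fact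
    show "Q\<^sup>T * Q = 1\<^sub>m n"
    proof (rule eq_matI)
      fix i j assume "i < dim_row (1\<^sub>m n :: real mat)" "j < dim_col (1\<^sub>m n :: real mat)"
      then have ij: "i < n" "j < n" by auto
      have "(Q\<^sup>T * Q) $$ (i, j) = (P\<^sup>T * P) $$ (f i, f j)"
        using P(1) ij f_less by (simp add: Q_def scalar_prod_def)
      then show "(Q\<^sup>T * Q) $$ (i, j) = 1\<^sub>m n $$ (i, j)"
        using ij f_less f_inj by (simp add: P(2))
    qed (use Q in auto)
    show "length (real_spectrum A) = n" by fact
    show "A = Q * mat_diag n (nth (real_spectrum A)) * Q\<^sup>T"
    proof (rule eq_matI)
      fix i j assume "i < dim_row (Q * mat_diag n (nth (real_spectrum A)) * Q\<^sup>T)"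
        "j < dim_col (Q * mat_diag n (nth (real_spectrum A)) * Q\<^sup>T)"
      then have ij: "i < n" "j < n" using Q by auto
      have "A $$ (i, j) = (\<Sum>l<n. P $$ (i, l) * d l * P $$ (j, l))"
        using entry[OF P(1) ij] by (simp add: A_eq)
      also have "\<dots> = (\<Sum>l<n. P $$ (i, f l) * d (f l) * P $$ (j, f l))"
        by (rule sum.reindex_bij_betw[OF f, symmetric])
      also have "\<dots> = (\<Sum>l<n. Q $$ (i, l) * real_spectrum A ! l * Q $$ (j, l))"
        using ij f_less by (intro sum.cong) (auto simp: nth Q_def)
      finally show "A $$ (i, j) = (Q * mat_diag n (nth (real_spectrum A)) * Q\<^sup>T) $$ (i, j)"
        by (simp only: entry[OF Q ij])
    qed (use Q A in auto)
  qed
qed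

text \<open>An orthogonal change to the coordinates \<open>P\<^sup>T *\<^sub>v x\<close> preserves
  the inner product and turns \<open>A\<close> into a diagonal matrix.\<close>

lemma quadratic_form_diagonalization:
  fixes A :: "real mat"
  assumes P: "P \<in> carrier_mat n n" "P\<^sup>T * P = 1\<^sub>m n" and A: "A = P * mat_diag n d * P\<^sup>T"
    and x: "x \<in> carrier_vec n" and y: "y \<in> carrier_vec n"
  shows "x \<bullet> y = (\<Sum>i<n. (P\<^sup>T *\<^sub>v x) $ i * (P\<^sup>T *\<^sub>v y) $ i)"
    and "x \<bullet> (A *\<^sub>v y) = (\<Sum>i<n. d i * ((P\<^sup>T *\<^sub>v x) $ i * (P\<^sup>T *\<^sub>v y) $ i))"
proof -
  have PT: "P\<^sup>T \<in> carrier_mat n n" using P by simp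
  have PPT: "P * P\<^sup>T = 1\<^sub>m n" using mat_mult_left_right_inverse[OF PT P] .
  have Py: "P\<^sup>T *\<^sub>v y \<in> carrier_vec n" using PT y by simp
  have "y = P *\<^sub>v (P\<^sup>T *\<^sub>v y)"
    using assoc_mult_mat_vec[OF P(1) PT y] y PPT by simp
  then have "x \<bullet> y = (P\<^sup>T *\<^sub>v x) \<bullet> (P\<^sup>T *\<^sub>v y)"
    using transpose_vec_mult_scalar[OF P(1) Py x] by simp
  then show "x \<bullet> y = (\<Sum>i<n. (P\<^sup>T *\<^sub>v x) $ i * (P\<^sup>T *\<^sub>v y) $ i)"
    using P by (simp add: scalar_prod_def atLeast0LessThan)
  have D: "mat_diag n d *\<^sub>v z = vec n (\<lambda>i. d i * z $ i)" if "z \<in> carrier_vec n" for z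
    using that by (auto simp: mat_diag_def scalar_prod_def if_distrib[of "\<lambda>x. x * _"] cong: if_cong)
  have "A *\<^sub>v y = P *\<^sub>v (mat_diag n d *\<^sub>v (P\<^sup>T *\<^sub>v y))"
    using P PT y Py by (simp add: A assoc_mult_mat_vec[of _ n n _ n])
  then have "x \<bullet> (A *\<^sub>v y) = (P\<^sup>T *\<^sub>v x) \<bullet> (mat_diag n d *\<^sub>v (P\<^sup>T *\<^sub>v y))"
    using transpose_vec_mult_scalar[OF P(1) _ x, of "mat_diag n d *\<^sub>v (P\<^sup>T *\<^sub>v y)"]
    by (simp add: D[OF Py])
  then show "x \<bullet> (A *\<^sub>v y) = (\<Sum>i<n. d i * ((P\<^sup>T *\<^sub>v x) $ i * (P\<^sup>T *\<^sub>v y) $ i))"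
    using P by (simp add: D[OF Py] scalar_prod_def atLeast0LessThan mult_ac)
qed

section \<open>Variational bounds for the second eigenvalue\<close>

lemma sorted_real_spectrum: "sorted (real_spectrum A)"
  by (simp add: real_spectrum_def)

text \<open>One half of the Courant-Fischer principle. The span of the first two eigenvectors meets
  the vectors orthogonal to \<open>w\<close> in a nonzero \<open>x\<close>; if the second eigenvalue
  were below \<open>c\<close>, the form at \<open>x\<close> would be too small.\<close>

lemma second_eigenvalue_ge:
  fixes A :: "real mat"
  assumes A: "A \<in> carrier_mat n n" "A\<^sup>T = A" and n: "2 \<le> n" and w: "w \<in> carrier_vec n"
    and form: "\<And>x. x \<in> carrier_vec n \<Longrightarrow> w \<bullet> x = 0 \<Longrightarrow> c * (x \<bullet> x) \<le> x \<bullet> (A *\<^sub>v x)"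
  shows "c \<le> real_spectrum A ! 1"
proof (rule ccontr)
  assume "\<not> ?thesis"
  then have less1: "real_spectrum A ! 1 < c" by simp
  obtain P where P: "P \<in> carrier_mat n n" "P\<^sup>T * P = 1\<^sub>m n" and len: "length (real_spectrum A) = n"
    and A_eq: "A = P * mat_diag n (nth (real_spectrum A)) * P\<^sup>T"
    using real_symmetric_sorted_diagonalization[OF A] .
  have less0: "real_spectrum A ! 0 < c"
    using less1 sorted_nth_mono[OF sorted_real_spectrum, of 0 1 A] len n by simp
  define p where "p = P\<^sup>T *\<^sub>v w"
  \<comment> \<open>\<open>s\<close> and \<open>t\<close> are the coordinates of \<open>x\<close>
    along the first two eigenvectors. Orthogonality to \<open>w\<close> is one linear equation in
    two unknowns, hence has a nontrivial solution.\<close>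
  obtain s t :: real where st: "p $ 0 * s + p $ 1 * t = 0" and nz: "s \<noteq> 0 \<or> t \<noteq> 0"
  proof (cases "p $ 0 = 0 \<and> p $ 1 = 0")
    case True
    then show ?thesis using that[of 1 1] by simp
  next
    case False
    then show ?thesis using that[of "- p $ 1" "p $ 0"] by (auto simp: mult.commute)
  qed
  define y where "y = vec n (\<lambda>i. if i = 0 then s else if i = 1 then t else 0)"
  define x where "x = P *\<^sub>v y"
  have y: "y \<in> carrier_vec n" and x: "x \<in> carrier_vec n"
    using P by (auto simp: y_def x_def)
  have Px: "P\<^sup>T *\<^sub>v x = y"
    using assoc_mult_mat_vec[of "P\<^sup>T" n n P n y] P y by (simp add: x_def)
  have sum2: "(\<Sum>i<n. g i) = g 0 + g 1" if "\<And>i. 1 < i \<Longrightarrow> g i = 0" for g :: "nat \<Rightarrow> real"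
  proof -
    have "(\<Sum>i<n. g i) = (\<Sum>i\<in>{0, 1}. g i)"
      by (rule sum.mono_neutral_right) (use n that in auto)
    then show ?thesis by simp
  qed
  note diag = quadratic_form_diagonalization[OF P A_eq]
  have "w \<bullet> x = (\<Sum>i<n. p $ i * (if i = 0 then s else if i = 1 then t else 0))"
    unfolding diag(1)[OF w x] Px p_def[symmetric] by (rule sum.cong) (auto simp: y_def)
  also have "\<dots> = 0" by (subst sum2) (use st in auto)
  finally have wx: "w \<bullet> x = 0" .
  have xx: "x \<bullet> x = s\<^sup>2 + t\<^sup>2"
  proof -
    have "x \<bullet> x = (\<Sum>i<n. if i = 0 then s\<^sup>2 else if i = 1 then t\<^sup>2 else 0)"
      unfolding diag(1)[OF x x] Px by (rule sum.cong) (auto simp: y_def power2_eq_square)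
    also have "\<dots> = s\<^sup>2 + t\<^sup>2" by (subst sum2) auto
    finally show ?thesis .
  qed
  have "x \<bullet> (A *\<^sub>v x) = (\<Sum>i<n. real_spectrum A ! i *
      (if i = 0 then s\<^sup>2 else if i = 1 then t\<^sup>2 else 0))"
    unfolding diag(2)[OF x x] Px by (rule sum.cong) (auto simp: y_def power2_eq_square)
  also have "\<dots> = real_spectrum A ! 0 * s\<^sup>2 + real_spectrum A ! 1 * t\<^sup>2"
    by (subst sum2) auto
  also have "\<dots> < c * s\<^sup>2 + c * t\<^sup>2"
    using nz less0 less1
    by (metis add_le_less_mono add_less_le_mono less_imp_le mult_right_mono mult_strict_right_mono
        zero_le_power2 zero_less_power2)
  also have "\<dots> = c * (x \<bullet> x)" by (simp add: xx algebra_simps)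
  also have "\<dots> \<le> x \<bullet> (A *\<^sub>v x)" using form[OF x wx] .
  finally show False by simp
qed

text \<open>As \<open>m\<close> lies below the second eigenvalue, \<open>u\<close> must be a
  multiple of the first eigenvector. Hence \<open>x\<close> has no component there, and all its
  other components carry eigenvalues at least \<open>c\<close>.\<close>

lemma quadratic_form_ge_second_eigenvalue:
  fixes A :: "real mat"
  assumes A: "A \<in> carrier_mat n n" "A\<^sup>T = A"
    and u: "u \<in> carrier_vec n" "u \<noteq> 0\<^sub>v n" "A *\<^sub>v u = m \<cdot>\<^sub>v u"
    and c: "m < c" "c \<le> real_spectrum A ! 1"
    and x: "x \<in> carrier_vec n" "u \<bullet> x = 0"
  shows "c * (x \<bullet> x) \<le> x \<bullet> (A *\<^sub>v x)"
proof -
  obtain P where P: "P \<in> carrier_mat n n" "P\<^sup>T * P = 1\<^sub>m n" and len: "length (real_spectrum A) = n"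
    and A_eq: "A = P * mat_diag n (nth (real_spectrum A)) * P\<^sup>T"
    using real_symmetric_sorted_diagonalization[OF A] .
  note diag = quadratic_form_diagonalization[OF P A_eq]
  have PPT: "P * P\<^sup>T = 1\<^sub>m n"
    using mat_mult_left_right_inverse[of "P\<^sup>T" n P] P by simp
  have ge: "c \<le> real_spectrum A ! i" if "0 < i" "i < n" for i
    using c(2) sorted_nth_mono[OF sorted_real_spectrum, of 1 i A] len that by simp
  define p where "p = P\<^sup>T *\<^sub>v u"
  have p: "p \<in> carrier_vec n" using P u by (simp add: p_def)
  have p0: "p $ i = 0" if i: "0 < i" "i < n" for i
  proof -
    let ?v = "col P i"
    have v: "?v \<in> carrier_vec n" using P i by simp
    have Pv: "P\<^sup>T *\<^sub>v ?v = unit_vec n i"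
    proof -
      have "P\<^sup>T *\<^sub>v ?v = col (P\<^sup>T * P) i" using P(1) i by (intro eq_vecI) auto
      then show ?thesis using i by (simp add: P(2))
    qed
    \<comment> \<open>The form at \<open>?v\<close> and \<open>u\<close> is evaluated through the
      eigenvalue of each; as these differ, the coordinate \<open>p $ i\<close> vanishes.\<close>
    have "real_spectrum A ! i * p $ i = ?v \<bullet> (A *\<^sub>v u)"
      unfolding diag(2)[OF v u(1)] Pv p_def[symmetric]
      using i by (simp add: unit_vec_def if_distrib[of "\<lambda>x. x * _"] if_distrib[of "\<lambda>x. _ * x"] cong: if_cong)
    also have "\<dots> = m * (?v \<bullet> u)" using u v by simp
    also have "?v \<bullet> u = p $ i"
      unfolding diag(1)[OF v u(1)] Pv p_def[symmetric]
      using i by (simp add: unit_vec_def if_distrib[of "\<lambda>x. x * _"] cong: if_cong)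
    finally show ?thesis using ge[OF i] c(1) by simp
  qed
  have "p $ 0 \<noteq> 0 \<and> 0 < n"
  proof (rule ccontr)
    assume "\<not> ?thesis"
    then have "p $ i = 0" if "i < n" for i
      using that p0[of i] by (cases "i = 0") auto
    then have "p = 0\<^sub>v n" using p by auto
    moreover have "u = P *\<^sub>v p"
      using assoc_mult_mat_vec[of P n n "P\<^sup>T" n u] P u PPT by (simp add: p_def)
    ultimately have "u = 0\<^sub>v n" using P by auto
    with u show False by simp
  qed
  then have n: "0 < n" and p00: "p $ 0 \<noteq> 0" by auto
  have "0 = (\<Sum>i<n. p $ i * (P\<^sup>T *\<^sub>v x) $ i)"
    using diag(1)[OF u(1) x(1)] x(2) by (simp add: p_def)
  also have "\<dots> = (\<Sum>i\<in>{0}. p $ i * (P\<^sup>T *\<^sub>v x) $ i)"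
    by (rule sum.mono_neutral_right) (use n p0 in auto)
  finally have x0: "(P\<^sup>T *\<^sub>v x) $ 0 = 0" using p00 by simp
  show ?thesis
    unfolding diag(1)[OF x(1) x(1)] diag(2)[OF x(1) x(1)] sum_distrib_left
  proof (rule sum_mono)
    fix i assume "i \<in> {..<n}"
    then show "c * ((P\<^sup>T *\<^sub>v x) $ i * (P\<^sup>T *\<^sub>v x) $ i)
      \<le> real_spectrum A ! i * ((P\<^sup>T *\<^sub>v x) $ i * (P\<^sup>T *\<^sub>v x) $ i)"
      using x0 ge[of i] by (cases "i = 0") (auto intro: mult_right_mono)
  qed
qed

section \<open>Laplacian and adjacency forms of a graph\<close>

definition neighbours :: "'a pair_pre_digraph \<Rightarrow> 'a \<Rightarrow> 'a set" where
  "neighbours G v = {u. (v, u) \<in> parcs G}"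

text \<open>The adjacency operator on functions, which avoids enumerating the vertices.\<close>

definition neighbour_sum :: "'a pair_pre_digraph \<Rightarrow> ('a \<Rightarrow> real) \<Rightarrow> 'a \<Rightarrow> real" where
  "neighbour_sum G f v = (\<Sum>u\<in>neighbours G v. f u)"

text \<open>Each edge contributes two arcs, so the Laplacian quadratic form is half of this.\<close>

definition energy :: "'a pair_pre_digraph \<Rightarrow> ('a \<Rightarrow> real) \<Rightarrow> real" where
  "energy G f = (\<Sum>(u, v)\<in>parcs G. (f u - f v)\<^sup>2)"

lemma simple_graphD:
  assumes "simple_graph G"
  shows "finite (pverts G)" "finite (parcs G)" "pverts G \<noteq> {}"
    and "(u, v) \<in> parcs G \<Longrightarrow> u \<in> pverts G"
    and "(u, v) \<in> parcs G \<Longrightarrow> v \<in> pverts G"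
    and "(u, v) \<in> parcs G \<Longrightarrow> (v, u) \<in> parcs G"
    and "(u, v) \<in> parcs G \<Longrightarrow> u \<noteq> v"
proof -
  have G: "pair_graph G" and "pverts G \<noteq> {}"
    using assms by (auto simp: simple_graph_def)
  interpret pair_graph G by (rule G)
  show "finite (pverts G)" "finite (parcs G)" "pverts G \<noteq> {}"
    by (fact pair_finite_verts pair_finite_arcs \<open>pverts G \<noteq> {}\<close>)+
  show "(u, v) \<in> parcs G \<Longrightarrow> u \<in> pverts G" "(u, v) \<in> parcs G \<Longrightarrow> v \<in> pverts G"
    by (auto dest: in_arcsD1 in_arcsD2)
  show "(u, v) \<in> parcs G \<Longrightarrow> (v, u) \<in> parcs G"
    using pair_sym_arcs by (auto simp: symmetric_def dest: symD)
  show "(u, v) \<in> parcs G \<Longrightarrow> u \<noteq> v"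
    using pair_no_loops by fastforce
qed

lemma finite_neighbours [intro]: "simple_graph G \<Longrightarrow> finite (neighbours G v)"
  by (rule finite_subset[of _ "pverts G"]) (auto simp: neighbours_def dest: simple_graphD)

lemma arc_sum_eq:
  assumes "simple_graph G"
  shows "(\<Sum>(v, u)\<in>parcs G. F v u) = (\<Sum>v\<in>pverts G. \<Sum>u\<in>neighbours G v. F v u)"
proof -
  have "parcs G = Sigma (pverts G) (neighbours G)"
    using simple_graphD[OF assms] by (auto simp: neighbours_def)
  then show ?thesis
    using simple_graphD(1)[OF assms] finite_neighbours[OF assms] by (simp add: sum.Sigma)
qed

lemma arc_sum_swap:
  assumes "simple_graph G"
  shows "(\<Sum>(u, v)\<in>parcs G. F u v) = (\<Sum>(u, v)\<in>parcs G. F v u)"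
  by (rule sum.reindex_bij_witness[of _ prod.swap prod.swap])
    (use simple_graphD[OF assms] in auto)

lemma out_degree_eq:
  "out_degree (with_proj G) v = card (neighbours G v)"
proof -
  have "out_arcs (with_proj G) v = Pair v ` neighbours G v"
    by (auto simp: neighbours_def out_arcs_def)
  then show ?thesis
    by (simp add: out_degree_def card_image inj_on_def)
qed

lemma sum_nth_distinct:
  assumes "distinct vs"
  shows "(\<Sum>i<length vs. g (vs ! i)) = (\<Sum>v\<in>set vs. g v)"
  by (rule sum.reindex_bij_betw) (rule bij_betw_nth[OF assms], auto)

lemma laplacian_carrier: "laplacian G vs \<in> carrier_mat (length vs) (length vs)"
  by (auto simp: laplacian_def degree_matrix_def adjacency_matrix_def)

lemma laplacian_symmetric:
  assumes "simple_graph G"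
  shows "(laplacian G vs)\<^sup>T = laplacian G vs"
  using simple_graphD(6)[OF assms] laplacian_carrier[of G vs]
  by (intro eq_matI) (auto simp: laplacian_index)

lemma laplacian_mult_vec:
  assumes "simple_graph G" "distinct vs" "set vs = pverts G"
  shows "laplacian G vs *\<^sub>v vec (length vs) (\<lambda>i. f (vs ! i)) =
    vec (length vs) (\<lambda>i. real (card (neighbours G (vs ! i))) * f (vs ! i) - neighbour_sum G f (vs ! i))"
    (is "?L *\<^sub>v ?x = ?y")
proof (rule eq_vecI)
  fix i assume "i < dim_vec ?y"
  then have i: "i < length vs" by simp
  let ?d = "real (card (neighbours G (vs ! i)))"
  have "(?L *\<^sub>v ?x) $ i = (\<Sum>j<length vs. ((if i = j then ?d else 0)
      - (if (vs ! i, vs ! j) \<in> parcs G then 1 else 0)) * f (vs ! j))"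
    using i laplacian_carrier[of G vs]
    by (auto simp: scalar_prod_def laplacian_index out_degree_eq atLeast0LessThan intro!: sum.cong)
  also have "\<dots> = (\<Sum>j<length vs. (if i = j then ?d * f (vs ! j) else 0)
      - (if vs ! j \<in> neighbours G (vs ! i) then f (vs ! j) else 0))"
    by (rule sum.cong) (auto simp: neighbours_def algebra_simps)
  also have "\<dots> = ?d * f (vs ! i) - (\<Sum>u\<in>pverts G. if u \<in> neighbours G (vs ! i) then f u else 0)"
    using i sum_nth_distinct[OF assms(2), of "\<lambda>u. if u \<in> neighbours G (vs ! i) then f u else 0"]
    by (simp add: sum_subtractf assms(3))
  also have "(\<Sum>u\<in>pverts G. if u \<in> neighbours G (vs ! i) then f u else 0) = neighbour_sum G f (vs ! i)"
    unfolding neighbour_sum_def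
    by (rule sum.mono_neutral_cong_right)
      (use simple_graphD[OF assms(1)] in \<open>auto simp: neighbours_def\<close>)
  finally show "(?L *\<^sub>v ?x) $ i = ?y $ i" using i by simp
qed (use laplacian_carrier[of G vs] in auto)

text \<open>Summation by parts: each square splits into two terms that are exchanged by reversing
  the arc.\<close>

lemma energy_eq:
  assumes "simple_graph G"
  shows "energy G f / 2 = (\<Sum>v\<in>pverts G. f v * (real (card (neighbours G v)) * f v - neighbour_sum G f v))"
proof -
  have "energy G f = (\<Sum>(v, u)\<in>parcs G. (f v)\<^sup>2 - f v * f u) + (\<Sum>(v, u)\<in>parcs G. (f u)\<^sup>2 - f u * f v)"
    unfolding energy_def sum.distrib[symmetric]
    by (rule sum.cong) (auto simp: power2_eq_square algebra_simps)
  also have "(\<Sum>(v, u)\<in>parcs G. (f u)\<^sup>2 - f u * f v) = (\<Sum>(v, u)\<in>parcs G. (f v)\<^sup>2 - f v * f u)"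
    by (rule arc_sum_swap[OF assms])
  finally have "energy G f / 2 = (\<Sum>(v, u)\<in>parcs G. (f v)\<^sup>2 - f v * f u)" by simp
  also have "\<dots> = (\<Sum>v\<in>pverts G. \<Sum>u\<in>neighbours G v. (f v)\<^sup>2 - f v * f u)"
    by (rule arc_sum_eq[OF assms])
  also have "\<dots> = (\<Sum>v\<in>pverts G. f v * (real (card (neighbours G v)) * f v - neighbour_sum G f v))"
    by (rule sum.cong)
      (simp_all add: sum_subtractf neighbour_sum_def sum_distrib_left power2_eq_square algebra_simps)
  finally show ?thesis .
qed

lemma laplacian_quadratic_form:
  assumes "simple_graph G" "distinct vs" "set vs = pverts G"
  shows "vec (length vs) (\<lambda>i. f (vs ! i)) \<bullet> (laplacian G vs *\<^sub>v vec (length vs) (\<lambda>i. f (vs ! i)))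
    = energy G f / 2"
  unfolding laplacian_mult_vec[OF assms] energy_eq[OF assms(1)]
  using sum_nth_distinct[OF assms(2), of "\<lambda>v. f v * (real (card (neighbours G v)) * f v - neighbour_sum G f v)"]
  by (simp add: scalar_prod_def atLeast0LessThan assms(3))

section \<open>Algebraic connectivity through the energy\<close>

lemma algebraic_connectivity_eq:
  assumes "simple_graph G"
  obtains vs where "distinct vs" "set vs = pverts G"
    "algebraic_connectivity G = real_spectrum (laplacian G vs) ! 1"
proof -
  \<comment> \<open>This is the enumeration chosen inside \<open>laplacian_spectrum\<close>, so the
    two spectra agree literally.\<close>
  define vs where "vs = (SOME vs. distinct vs \<and> set vs = pverts G)"
  have "distinct vs \<and> set vs = pverts G"
    unfolding vs_def
    by (rule someI_ex) (use finite_distinct_list[OF simple_graphD(1)[OF assms]] in blast)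
  then show ?thesis
    by (intro that[of vs])
      (simp_all add: algebraic_connectivity_def laplacian_spectrum_def real_spectrum_def vs_def)
qed

text \<open>The weight \<open>w\<close> is left free because the application takes the indicator of
  the copy of \<open>G\<close> in the corona instead of the constant function.\<close>

lemma algebraic_connectivity_ge:
  fixes w :: "'a \<Rightarrow> real"
  assumes G: "simple_graph G" and card: "2 \<le> card (pverts G)"
    and form: "\<And>f. (\<Sum>v\<in>pverts G. w v * f v) = 0 \<Longrightarrow> c * (\<Sum>v\<in>pverts G. (f v)\<^sup>2) \<le> energy G f / 2"
  shows "c \<le> algebraic_connectivity G"
proof -
  obtain vs where vs: "distinct vs" "set vs = pverts G"
    and eq: "algebraic_connectivity G = real_spectrum (laplacian G vs) ! 1"
    using algebraic_connectivity_eq[OF G] .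
  let ?n = "length vs"
  have sum_vs: "(\<Sum>i<?n. g (vs ! i)) = (\<Sum>v\<in>pverts G. g v)" for g :: "'a \<Rightarrow> real"
    using sum_nth_distinct[OF vs(1)] vs(2) by metis
  show ?thesis
    unfolding eq
  proof (rule second_eigenvalue_ge[OF laplacian_carrier laplacian_symmetric[OF G]])
    show "2 \<le> ?n" using card vs by (metis distinct_card)
    show "vec ?n (\<lambda>i. w (vs ! i)) \<in> carrier_vec ?n" by simp
    fix x :: "real vec"
    assume x: "x \<in> carrier_vec ?n" and wx: "vec ?n (\<lambda>i. w (vs ! i)) \<bullet> x = 0"
    \<comment> \<open>\<open>f\<close> reads \<open>x\<close> as a function on the vertices; its
      values elsewhere are arbitrary and do not enter the sums.\<close>
    define f where "f v = x $ inv_into {..<?n} (nth vs) v" for v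
    have "inj_on (nth vs) {..<?n}" using vs(1) by (auto intro: inj_on_nth)
    then have x_eq: "x = vec ?n (\<lambda>i. f (vs ! i))"
      using x by (auto simp: f_def)
    have "(\<Sum>v\<in>pverts G. w v * f v) = 0"
      using wx by (simp add: x_eq scalar_prod_def atLeast0LessThan sum_vs[of "\<lambda>v. w v * f v"])
    then have "c * (\<Sum>v\<in>pverts G. (f v)\<^sup>2) \<le> energy G f / 2" by (rule form)
    moreover have "x \<bullet> x = (\<Sum>v\<in>pverts G. (f v)\<^sup>2)"
      using sum_vs[of "\<lambda>v. (f v)\<^sup>2"]
      by (simp add: x_eq scalar_prod_def atLeast0LessThan power2_eq_square)
    ultimately show "c * (x \<bullet> x) \<le> x \<bullet> (laplacian G vs *\<^sub>v x)"
      using laplacian_quadratic_form[OF G vs, of f] by (simp only: x_eq)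
  qed
qed

text \<open>The constant function is an eigenvector for 0, which lies below the second eigenvalue
  because \<open>0 < c\<close>; functions with sum 0 are those orthogonal to it.\<close>

lemma energy_ge_algebraic_connectivity:
  assumes G: "simple_graph G" and c: "0 < c" "c \<le> algebraic_connectivity G"
    and f: "(\<Sum>v\<in>pverts G. f v) = 0"
  shows "c * (\<Sum>v\<in>pverts G. (f v)\<^sup>2) \<le> energy G f / 2"
proof -
  obtain vs where vs: "distinct vs" "set vs = pverts G"
    and eq: "algebraic_connectivity G = real_spectrum (laplacian G vs) ! 1"
    using algebraic_connectivity_eq[OF G] .
  let ?n = "length vs"
  define u :: "real vec" where "u = vec ?n (\<lambda>i. (\<lambda>_. 1) (vs ! i))"
  define x where "x = vec ?n (\<lambda>i. f (vs ! i))"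
  have sum_vs: "(\<Sum>i<?n. g (vs ! i)) = (\<Sum>v\<in>pverts G. g v)" for g :: "'a \<Rightarrow> real"
    using sum_nth_distinct[OF vs(1)] vs(2) by metis
  have n: "0 < ?n" using vs simple_graphD(3)[OF G] by auto
  have "c * (x \<bullet> x) \<le> x \<bullet> (laplacian G vs *\<^sub>v x)"
  proof (rule quadratic_form_ge_second_eigenvalue[OF laplacian_carrier laplacian_symmetric[OF G]])
    show "u \<in> carrier_vec ?n" "x \<in> carrier_vec ?n" by (simp_all add: u_def x_def)
    show "u \<noteq> 0\<^sub>v ?n"
    proof
      assume "u = 0\<^sub>v ?n"
      then have "u $ 0 = 0" using n by simp
      then show False using n by (simp add: u_def)
    qed
    show "laplacian G vs *\<^sub>v u = 0 \<cdot>\<^sub>v u"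
      using laplacian_mult_vec[OF G vs, of "\<lambda>_. 1"] by (auto simp: u_def neighbour_sum_def)
    show "0 < c" "c \<le> real_spectrum (laplacian G vs) ! 1" using c eq by auto
    show "u \<bullet> x = 0"
      using f by (simp add: u_def x_def scalar_prod_def atLeast0LessThan sum_vs)
  qed
  moreover have "x \<bullet> x = (\<Sum>v\<in>pverts G. (f v)\<^sup>2)"
    using sum_vs[of "\<lambda>v. (f v)\<^sup>2"]
    by (simp add: x_def scalar_prod_def atLeast0LessThan power2_eq_square)
  ultimately show ?thesis
    using laplacian_quadratic_form[OF G vs, of f] by (simp add: x_def)
qed


section \<open>Bounds for the adjacency operator of a regular graph\<close>

lemma regular_graph_neighbours:
  "regular_graph k G \<Longrightarrow> v \<in> pverts G \<Longrightarrow> card (neighbours G v) = k"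
  by (simp add: regular_graph_def out_degree_eq)

text \<open>Self-adjointness of the adjacency operator, from the symmetry of the arcs.\<close>

lemma sum_mult_neighbour_sum:
  assumes "simple_graph G"
  shows "(\<Sum>v\<in>pverts G. f v * neighbour_sum G g v) = (\<Sum>v\<in>pverts G. neighbour_sum G f v * g v)"
proof -
  have "(\<Sum>v\<in>pverts G. f v * neighbour_sum G g v) = (\<Sum>(v, u)\<in>parcs G. f v * g u)"
    by (simp add: arc_sum_eq[OF assms] neighbour_sum_def sum_distrib_left)
  also have "\<dots> = (\<Sum>(v, u)\<in>parcs G. f u * g v)"
    by (rule arc_sum_swap[OF assms])
  also have "\<dots> = (\<Sum>v\<in>pverts G. neighbour_sum G f v * g v)"
    by (simp add: arc_sum_eq[OF assms] neighbour_sum_def sum_distrib_right)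
  finally show ?thesis .
qed

lemma neighbour_sum_linear:
  "neighbour_sum G (\<lambda>v. a * f v + b * g v) v = a * neighbour_sum G f v + b * neighbour_sum G g v"
  by (simp add: neighbour_sum_def sum.distrib sum_distrib_left)

context
  fixes G :: "'a pair_pre_digraph" and k :: nat
  assumes G: "simple_graph G" and reg: "regular_graph k G"
begin

text \<open>In particular, the adjacency operator preserves the functions with sum 0.\<close>

lemma sum_neighbour_sum: "(\<Sum>v\<in>pverts G. neighbour_sum G f v) = real k * (\<Sum>v\<in>pverts G. f v)"
proof -
  have "(\<Sum>v\<in>pverts G. neighbour_sum G f v) = (\<Sum>v\<in>pverts G. neighbour_sum G (\<lambda>_. 1) v * f v)"
    using sum_mult_neighbour_sum[OF G, of "\<lambda>_. 1" f] by simp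
  also have "\<dots> = real k * (\<Sum>v\<in>pverts G. f v)"
    by (simp add: neighbour_sum_def regular_graph_neighbours[OF reg] sum_distrib_left)
  finally show ?thesis .
qed

lemma energy_regular:
  "energy G f / 2 = real k * (\<Sum>v\<in>pverts G. (f v)\<^sup>2) - (\<Sum>v\<in>pverts G. f v * neighbour_sum G f v)"
  unfolding energy_eq[OF G]
  by (simp add: regular_graph_neighbours[OF reg] right_diff_distrib sum_subtractf
      sum_distrib_left power2_eq_square mult.left_commute)

text \<open>The signless Laplacian form, a sum of squares \<open>(f v + f u)\<^sup>2\<close>, is
  nonnegative. Equivalently, no Laplacian eigenvalue exceeds \<open>2 * k\<close>.\<close>

lemma adjacency_form_ge:
  "- real k * (\<Sum>v\<in>pverts G. (f v)\<^sup>2) \<le> (\<Sum>v\<in>pverts G. f v * neighbour_sum G f v)"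
proof -
  have "0 \<le> (\<Sum>(v, u)\<in>parcs G. (f v + f u)\<^sup>2)"
    by (rule sum_nonneg) auto
  also have "\<dots> = (\<Sum>(v, u)\<in>parcs G. (f v)\<^sup>2 + f v * f u) + (\<Sum>(v, u)\<in>parcs G. (f u)\<^sup>2 + f u * f v)"
    unfolding sum.distrib[symmetric]
    by (rule sum.cong) (auto simp: power2_eq_square algebra_simps)
  also have "(\<Sum>(v, u)\<in>parcs G. (f u)\<^sup>2 + f u * f v) = (\<Sum>(v, u)\<in>parcs G. (f v)\<^sup>2 + f v * f u)"
    by (rule arc_sum_swap[OF G])
  finally have "0 \<le> (\<Sum>(v, u)\<in>parcs G. (f v)\<^sup>2 + f v * f u)" by simp
  also have "\<dots> = real k * (\<Sum>v\<in>pverts G. (f v)\<^sup>2) + (\<Sum>v\<in>pverts G. f v * neighbour_sum G f v)"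
    by (simp add: arc_sum_eq[OF G] sum.distrib regular_graph_neighbours[OF reg]
        neighbour_sum_def sum_distrib_left)
  finally show ?thesis by simp
qed

lemma adjacency_form_le:
  assumes "0 < \<epsilon>" "\<epsilon> \<le> algebraic_connectivity G" "(\<Sum>v\<in>pverts G. f v) = 0"
  shows "(\<Sum>v\<in>pverts G. f v * neighbour_sum G f v) \<le> (real k - \<epsilon>) * (\<Sum>v\<in>pverts G. (f v)\<^sup>2)"
  using energy_ge_algebraic_connectivity[OF G assms] energy_regular[of f]
  by (simp add: algebra_simps)

text \<open>Tested on the difference of the indicators of two adjacent vertices, with squared norm 2
  and adjacency form -2. It serves to give \<open>\<epsilon> < 2 * k\<close>.\<close>

lemma algebraic_connectivity_le_degree:
  assumes "0 < k" "0 < \<epsilon>" "\<epsilon> \<le> algebraic_connectivity G"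
  shows "\<epsilon> \<le> real k + 1"
proof -
  note D = simple_graphD[OF G]
  obtain u where u: "u \<in> pverts G" using D(3) by blast
  then have "neighbours G u \<noteq> {}" using regular_graph_neighbours[OF reg u] assms(1) by auto
  then obtain v where uv: "(u, v) \<in> parcs G" by (auto simp: neighbours_def)
  then have vu: "(v, u) \<in> parcs G" and v: "v \<in> pverts G" and neq: "u \<noteq> v"
    using D(5-7) by blast+
  define f :: "'a \<Rightarrow> real" where "f w = (if w = u then 1 else 0) - (if w = v then 1 else 0)" for w
  have nu: "neighbour_sum G f u = -1" and nv: "neighbour_sum G f v = 1"
    using uv vu D(7) finite_neighbours[OF G]
    by (auto simp: neighbour_sum_def f_def sum_subtractf neighbours_def)
  have "(\<Sum>w\<in>pverts G. f w) = 0"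
    using u v D(1) by (simp add: f_def sum_subtractf)
  moreover have "(\<Sum>w\<in>pverts G. (f w)\<^sup>2) = (\<Sum>w\<in>{u, v}. (f w)\<^sup>2)"
    by (rule sum.mono_neutral_right) (use u v D(1) in \<open>auto simp: f_def\<close>)
  moreover have "(\<Sum>w\<in>pverts G. f w * neighbour_sum G f w) = (\<Sum>w\<in>{u, v}. f w * neighbour_sum G f w)"
    by (rule sum.mono_neutral_right) (use u v D(1) in \<open>auto simp: f_def\<close>)
  ultimately show ?thesis
    using adjacency_form_le[OF assms(2,3), of f] neq nu nv by (simp add: f_def)
qed

text \<open>With A the adjacency operator, B = k - \<epsilon> - A and C = k + A, this says that the
  form of BC is nonnegative at \<open>f\<close>.\<close>

lemma adjacency_square_le:
  assumes \<epsilon>: "0 < \<epsilon>" "\<epsilon> \<le> algebraic_connectivity G" "\<epsilon> < 2 * real k"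
    and f: "(\<Sum>v\<in>pverts G. f v) = 0"
  shows "(\<Sum>v\<in>pverts G. (neighbour_sum G f v)\<^sup>2)
    \<le> (real k - \<epsilon>) * real k * (\<Sum>v\<in>pverts G. (f v)\<^sup>2)
      - \<epsilon> * (\<Sum>v\<in>pverts G. f v * neighbour_sum G f v)"
proof -
  define c where "c = real k - \<epsilon>"
  define X where "X = (\<Sum>v\<in>pverts G. (f v)\<^sup>2)"
  define Y where "Y = (\<Sum>v\<in>pverts G. f v * neighbour_sum G f v)"
  define Z where "Z = (\<Sum>v\<in>pverts G. (neighbour_sum G f v)\<^sup>2)"
  define T where "T = (\<Sum>v\<in>pverts G. neighbour_sum G f v * neighbour_sum G (neighbour_sum G f) v)"
  have Z_eq: "Z = (\<Sum>v\<in>pverts G. f v * neighbour_sum G (neighbour_sum G f) v)"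
    unfolding Z_def power2_eq_square by (rule sum_mult_neighbour_sum[OF G, symmetric])
  define g where "g s t v = s * f v + t * neighbour_sum G f v" for s t v
  have sum_g: "(\<Sum>v\<in>pverts G. g s t v) = 0" for s t
    using f by (simp add: g_def sum.distrib sum_neighbour_sum flip: sum_distrib_left)
  have sq: "(\<Sum>v\<in>pverts G. (g s t v)\<^sup>2) = s\<^sup>2 * X + 2 * s * t * Y + t\<^sup>2 * Z" for s t
    unfolding X_def Y_def Z_def sum_distrib_left sum.distrib[symmetric]
    by (rule sum.cong) (simp_all add: g_def power2_eq_square algebra_simps)
  have form: "(\<Sum>v\<in>pverts G. g s t v * neighbour_sum G (g s t) v) = s\<^sup>2 * Y + 2 * s * t * Z + t\<^sup>2 * T" for s t
  proof -
    have "(\<Sum>v\<in>pverts G. g s t v * neighbour_sum G (g s t) v) = s\<^sup>2 * Y + s * t * Z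
      + s * t * (\<Sum>v\<in>pverts G. f v * neighbour_sum G (neighbour_sum G f) v) + t\<^sup>2 * T"
      unfolding Y_def Z_def T_def sum_distrib_left sum.distrib[symmetric]
      by (rule sum.cong)
        (simp_all add: g_def[abs_def] neighbour_sum_linear power2_eq_square algebra_simps)
    then show ?thesis by (simp add: Z_eq)
  qed
  \<comment> \<open>The form of B is nonnegative at C f, which has sum 0 as well.\<close>
  have "(real k)\<^sup>2 * Y + 2 * real k * Z + T \<le> c * ((real k)\<^sup>2 * X + 2 * real k * Y + Z)"
    using adjacency_form_le[OF \<epsilon>(1,2) sum_g, of "real k" 1] form[of "real k" 1] sq[of "real k" 1]
    by (simp add: c_def)
  \<comment> \<open>The form of C is nonnegative at B f. In the sum of both inequalities the cubic
    term \<open>T\<close> cancels.\<close>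
  moreover have "- real k * (c\<^sup>2 * X - 2 * c * Y + Z) \<le> c\<^sup>2 * Y - 2 * c * Z + T"
    using adjacency_form_ge[of "g c (-1)"] form[of c "-1"] sq[of c "-1"] by simp
  ultimately have "0 \<le> c * ((real k)\<^sup>2 * X + 2 * real k * Y + Z) - ((real k)\<^sup>2 * Y + 2 * real k * Z + T)
      + (c\<^sup>2 * Y - 2 * c * Z + T + real k * (c\<^sup>2 * X - 2 * c * Y + Z))"
    by linarith
  also have "\<dots> = (real k + c) * (c * real k * X - \<epsilon> * Y - Z)"
    by (simp add: c_def power2_eq_square algebra_simps)
  finally have "0 \<le> c * real k * X - \<epsilon> * Y - Z"
    using \<epsilon>(3) by (simp add: c_def zero_le_mult_iff)
  then show ?thesis
    by (simp add: c_def X_def Y_def Z_def)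
qed

end

section \<open>The neighbourhood corona\<close>

lemma f_fun_eq:
  "f_fun n k x = (x + (real n + 1) * real k)
     - sqrt ((real n * real k + x - real k)\<^sup>2 + 4 * real n * (real k - x)\<^sup>2)"
  by (simp add: f_fun_def power2_eq_square algebra_simps)

text \<open>The radicand is the squared trace minus four times the determinant
  \<open>x * ((2 * n + 1) * k - n * x)\<close> of the block, and the second assumption makes this
  determinant positive.\<close>

lemma f_fun_pos:
  assumes "0 < x" "real n * x < (2 * real n + 1) * real k"
  shows "0 < f_fun n k x"
proof -
  have "(real n * real k + x - real k)\<^sup>2 + 4 * real n * (real k - x)\<^sup>2
      = (x + (real n + 1) * real k)\<^sup>2 - 4 * (x * ((2 * real n + 1) * real k - real n * x))"
    by (simp add: power2_eq_square algebra_simps)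
  also have "\<dots> < (x + (real n + 1) * real k)\<^sup>2"
    using assms by simp
  finally show ?thesis
    using assms by (simp add: f_fun_eq real_less_lsqrt)
qed

text \<open>Half of \<open>f_fun n k x\<close> is the smaller eigenvalue of the $2 \times 2$ matrix with diagonal
  entries $nk + x$, $k$ and off-diagonal entries $-\sqrt{n}(k - x)$, which is the block of the
  Laplacian of the corona that belongs to an eigenvalue \<open>x\<close> of \<open>G\<close>.\<close>
lemma corona_block_psd:
  assumes "d \<le> f_fun n k x / 2"
  shows "real n * (real k - x)\<^sup>2 \<le> (real n * real k + x - d) * (real k - d)"
proof -
  define R where "R = (real n * real k + x - real k)\<^sup>2 + 4 * real n * (real k - x)\<^sup>2"
  have R: "0 \<le> R" by (simp add: R_def)
  have "sqrt R \<le> x + (real n + 1) * real k - 2 * d"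
    using assms by (simp add: f_fun_eq R_def)
  \<comment> \<open>The right side minus \<open>R\<close> is four times the determinant of the block
    shifted by \<open>d\<close>.\<close>
  then have "(sqrt R)\<^sup>2 \<le> (x + (real n + 1) * real k - 2 * d)\<^sup>2"
    using R by (intro power_mono) auto
  then have "R \<le> (x + (real n + 1) * real k - 2 * d)\<^sup>2" using R by simp
  then show ?thesis by (simp add: R_def power2_eq_square algebra_simps)
qed

text \<open>This yields \<open>delta n k \<epsilon> < k\<close>, so that the square in the values on
  the copies of \<open>H\<close> can be completed.\<close>

lemma f_fun_double_less:
  assumes "0 < n" "0 < k"
  shows "f_fun n k (2 * real k) < 2 * real k"
proof -
  have "(real n + 1) * real k = sqrt (((real n + 1) * real k)\<^sup>2)" by simp
  also have "\<dots> < sqrt ((real n * real k + 2 * real k - real k)\<^sup>2 + 4 * real n * (real k - 2 * real k)\<^sup>2)"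
    using assms by (intro real_sqrt_less_mono) (simp add: power2_eq_square algebra_simps)
  finally show ?thesis by (simp add: f_fun_eq)
qed

text \<open>After the upper bound for \<open>Z\<close> is inserted, the claim is linear in \<open>(X, Y)\<close>, and the two
  assumptions on \<open>d\<close> are the claim on the extreme rays $Y = cX$ and $Y = -kX$.\<close>
lemma block_bound:
  fixes k c n q d X Y Z :: real
  assumes "Y \<le> c * X" "- k * X \<le> Y" "Z \<le> c * k * X - (k - c) * Y"
    and "n * c\<^sup>2 \<le> (n * k + (k - c) - d) * q" "n * k\<^sup>2 \<le> (n * k + 2 * k - d) * q"
    and "0 < q" "0 < k + c" "0 \<le> n"
  shows "n * Z / q \<le> ((n + 1) * k - d) * X - Y"
proof -
  \<comment> \<open>\<open>p1\<close> and \<open>p2\<close> are \<open>q\<close> times the values at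
    \<epsilon> = k - c and at 2k of the concave polynomial p. Weighted by \<open>k * X + Y\<close>
    and \<open>c * X - Y\<close>, each is the only term left on one extreme ray.\<close>
  define p1 where "p1 = (n * k + (k - c) - d) * q - n * c\<^sup>2"
  define p2 where "p2 = (n * k + 2 * k - d) * q - n * k\<^sup>2"
  have "0 \<le> p1" "0 \<le> p2" "0 \<le> k * X + Y" "0 \<le> c * X - Y"
    using assms(1,2,4,5) by (simp_all add: p1_def p2_def)
  then have "0 \<le> p1 * (k * X + Y) + p2 * (c * X - Y)"
    by (metis add_nonneg_nonneg mult_nonneg_nonneg)
  also have "\<dots> = (k + c) * (q * (((n + 1) * k - d) * X - Y) - n * (c * k * X - (k - c) * Y))"
    by (simp add: p1_def p2_def power2_eq_square algebra_simps)
  finally have "n * (c * k * X - (k - c) * Y) \<le> q * (((n + 1) * k - d) * X - Y)"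
    using assms(7) by (simp add: zero_le_mult_iff)
  moreover have "n * Z \<le> n * (c * k * X - (k - c) * Y)"
    using assms(3,8) by (rule mult_left_mono)
  ultimately show ?thesis
    using assms(6) by (simp add: divide_le_eq mult.commute)
qed

section \<open>Energy of a graph containing the corona\<close>

lemma energy_corona_ge:
  assumes G: "simple_graph G" and G': "simple_graph G'" and H: "finite (pverts H)"
    and sub: "parcs (G \<star> H) \<subseteq> parcs G'"
  shows "energy G (\<lambda>v. y (Inl v)) / 2
      + (\<Sum>(v, u)\<in>parcs G. \<Sum>x\<in>pverts H. (y (Inl u) - y (Inr (v, x)))\<^sup>2) \<le> energy G' y / 2"
proof -
  let ?g = "\<lambda>(p, q). (y p - y q)\<^sup>2"
  define \<iota> :: "'a \<times> 'a \<Rightarrow> ('a + 'a \<times> 'b) \<times> ('a + 'a \<times> 'b)" where "\<iota> = (\<lambda>(u, v). (Inl u, Inl v))"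
  define \<phi> :: "('a \<times> 'a) \<times> 'b \<Rightarrow> ('a + 'a \<times> 'b) \<times> ('a + 'a \<times> 'b)"
    where "\<phi> = (\<lambda>((v, u), x). (Inl u, Inr (v, x)))"
  let ?C = "parcs G \<times> pverts H"
  \<comment> \<open>\<open>?A2\<close> and \<open>?A3\<close> are the two orientations of the
    joining edges, which offsets the factor 1/2 in the claim. All other arcs contribute nonnegative
    terms and are dropped.\<close>
  let ?A1 = "\<iota> ` parcs G" and ?A2 = "\<phi> ` ?C" and ?A3 = "(prod.swap \<circ> \<phi>) ` ?C"
  have fin: "finite (parcs G)" "finite ?C" "finite (parcs G')"
    using simple_graphD(2)[OF G] simple_graphD(2)[OF G'] H by auto
  have sub': "?A1 \<union> ?A2 \<union> ?A3 \<subseteq> parcs G'"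
    using sub by (auto simp: \<iota>_def \<phi>_def neighbourhood_corona_def)
  have "sum ?g ?A1 = energy G (\<lambda>v. y (Inl v))"
    unfolding energy_def
    by (subst sum.reindex) (auto simp: \<iota>_def inj_on_def intro!: sum.cong)
  moreover have "sum ?g ?A2 = (\<Sum>(v, u)\<in>parcs G. \<Sum>x\<in>pverts H. (y (Inl u) - y (Inr (v, x)))\<^sup>2)"
    by (subst sum.reindex)
      (auto simp: \<phi>_def inj_on_def sum.cartesian_product split_def intro!: sum.cong)
  moreover have "sum ?g ?A3 = (\<Sum>(v, u)\<in>parcs G. \<Sum>x\<in>pverts H. (y (Inl u) - y (Inr (v, x)))\<^sup>2)"
    by (subst sum.reindex)
      (auto simp: \<phi>_def inj_on_def sum.cartesian_product split_def power2_commute intro!: sum.cong)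
  moreover have "sum ?g (?A1 \<union> ?A2 \<union> ?A3) = sum ?g ?A1 + sum ?g ?A2 + sum ?g ?A3"
  proof -
    have "(?A1 \<union> ?A2) \<inter> ?A3 = {}" "?A1 \<inter> ?A2 = {}"
      by (auto simp: \<iota>_def \<phi>_def)
    then show ?thesis using fin by (simp only: sum.union_disjoint finite_imageI finite_UnI)
  qed
  moreover have "sum ?g (?A1 \<union> ?A2 \<union> ?A3) \<le> energy G' y"
    unfolding energy_def by (rule sum_mono2[OF fin(3) sub']) auto
  ultimately show ?thesis by simp
qed

text \<open>Only vectors whose part on the copy of \<open>G\<close> sums to 0 are considered. As these form a
  hyperplane, this is enough to bound the second eigenvalue, and the values on the copies of
  \<open>H\<close> are left unconstrained, so that they can be minimised one at a time.\<close>
lemma corona_energy_bound: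
  assumes k: "0 < k" and G: "simple_graph G" and reg: "regular_graph k G"
    and \<epsilon>: "0 < \<epsilon>" "\<epsilon> \<le> algebraic_connectivity G" "\<epsilon> < 2 * real k"
    and G': "simple_graph G'" and H: "finite (pverts H)" "card (pverts H) = n"
    and sub: "parcs (G \<star> H) \<subseteq> parcs G'" and verts: "pverts G' = pverts (G \<star> H)"
    and d: "d \<le> f_fun n k \<epsilon> / 2" "d \<le> f_fun n k (2 * real k) / 2" "d < real k"
    and y: "(\<Sum>v\<in>pverts G. y (Inl v)) = 0"
  shows "d * (\<Sum>p\<in>pverts G'. (y p)\<^sup>2) \<le> energy G' y / 2"
proof -
  let ?V = "pverts G" and ?W = "pverts H"
  define a where "a v = y (Inl v)" for v
  define b where "b v x = y (Inr (v, x))" for v x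
  define q where "q = real k - d"
  have q: "0 < q" using d by (simp add: q_def)
  define X where "X = (\<Sum>v\<in>?V. (a v)\<^sup>2)"
  define Y where "Y = (\<Sum>v\<in>?V. a v * neighbour_sum G a v)"
  define Z where "Z = (\<Sum>v\<in>?V. (neighbour_sum G a v)\<^sup>2)"
  define B where "B = (\<Sum>v\<in>?V. \<Sum>x\<in>?W. (b v x)\<^sup>2)"
  have a: "(\<Sum>v\<in>?V. a v) = 0" using y by (simp add: a_def)
  have total: "(\<Sum>p\<in>pverts G'. (y p)\<^sup>2) = X + B"
  proof -
    have "(\<Sum>p\<in>pverts G'. (y p)\<^sup>2) = (\<Sum>v\<in>?V. (y (Inl v))\<^sup>2) + (\<Sum>p\<in>?V \<times> ?W. (y (Inr p))\<^sup>2)"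
      unfolding verts using simple_graphD(1)[OF G] H(1)
      by (simp add: neighbourhood_corona_def sum.Plus)
    then show ?thesis by (simp add: X_def B_def a_def b_def sum.cartesian_product split_def)
  qed
  have neighbour_sq: "(\<Sum>v\<in>?V. neighbour_sum G (\<lambda>u. (a u)\<^sup>2) v) = real k * X"
    unfolding X_def by (rule sum_neighbour_sum[OF G reg])
  \<comment> \<open>Completing the square in \<open>b v x\<close>: the minimum is attained where
    \<open>b v x\<close> equals the neighbour sum of \<open>a\<close> divided by
    \<open>q\<close>.\<close>
  have min: "(d * (b v x)\<^sup>2 - (neighbour_sum G a v)\<^sup>2 / q)
      \<le> real k * (b v x)\<^sup>2 - 2 * neighbour_sum G a v * b v x" for v x
  proof -
    have "0 \<le> (q * b v x - neighbour_sum G a v)\<^sup>2 / q" using q by simp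
    also have "\<dots> = q * (b v x)\<^sup>2 - 2 * neighbour_sum G a v * b v x + (neighbour_sum G a v)\<^sup>2 / q"
      using q by (simp add: power2_eq_square field_simps)
    finally show ?thesis by (simp add: q_def algebra_simps)
  qed
  have "d * B - real n * Z / q
      = (\<Sum>v\<in>?V. \<Sum>x\<in>?W. d * (b v x)\<^sup>2 - (neighbour_sum G a v)\<^sup>2 / q)"
    by (simp add: B_def Z_def sum_subtractf H(2) sum_distrib_left sum_divide_distrib)
  also have "\<dots> \<le> (\<Sum>v\<in>?V. \<Sum>x\<in>?W. real k * (b v x)\<^sup>2 - 2 * neighbour_sum G a v * b v x)"
    by (intro sum_mono min)
  also have "\<dots> = (\<Sum>v\<in>?V. \<Sum>x\<in>?W. \<Sum>u\<in>neighbours G v. (a u - b v x)\<^sup>2) - real n * real k * X"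
  proof -
    have "(\<Sum>u\<in>neighbours G v. (a u - b v x)\<^sup>2)
        = neighbour_sum G (\<lambda>u. (a u)\<^sup>2) v + (real k * (b v x)\<^sup>2 - 2 * neighbour_sum G a v * b v x)"
      if "v \<in> ?V" for v x
      using regular_graph_neighbours[OF reg that]
      by (simp add: neighbour_sum_def power2_diff sum.distrib sum_subtractf sum_distrib_left
          sum_distrib_right algebra_simps)
    then have "(\<Sum>v\<in>?V. \<Sum>x\<in>?W. \<Sum>u\<in>neighbours G v. (a u - b v x)\<^sup>2)
        = (\<Sum>v\<in>?V. \<Sum>x\<in>?W. neighbour_sum G (\<lambda>u. (a u)\<^sup>2) v)
          + (\<Sum>v\<in>?V. \<Sum>x\<in>?W. real k * (b v x)\<^sup>2 - 2 * neighbour_sum G a v * b v x)"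
      by (simp only: sum.distrib cong: sum.cong)
    moreover have "(\<Sum>v\<in>?V. \<Sum>x\<in>?W. neighbour_sum G (\<lambda>u. (a u)\<^sup>2) v) = real n * real k * X"
      by (simp add: H(2) neighbour_sq flip: sum_distrib_left)
    ultimately show ?thesis by simp
  qed
  also have "(\<Sum>v\<in>?V. \<Sum>x\<in>?W. \<Sum>u\<in>neighbours G v. (a u - b v x)\<^sup>2)
      = (\<Sum>v\<in>?V. \<Sum>u\<in>neighbours G v. \<Sum>x\<in>?W. (a u - b v x)\<^sup>2)"
    by (intro sum.cong refl sum.swap)
  also have "\<dots> = (\<Sum>(v, u)\<in>parcs G. \<Sum>x\<in>?W. (a u - b v x)\<^sup>2)"
    by (rule arc_sum_eq[OF G, symmetric])
  also have "\<dots> \<le> energy G' y / 2 - energy G a / 2"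
    using energy_corona_ge[OF G G' H(1) sub, of y] by (simp add: a_def[abs_def] b_def)
  also have "energy G a / 2 = real k * X - Y"
    unfolding X_def Y_def by (rule energy_regular[OF G reg])
  finally have energy: "d * B - real n * Z / q + real n * real k * X + real k * X - Y \<le> energy G' y / 2"
    by linarith
  \<comment> \<open>With the values on the copies eliminated, only this inequality in
    \<open>a\<close> remains; \<open>X\<close>, \<open>Y\<close>, \<open>Z\<close> are its forms for
    the identity, the adjacency operator and its square.\<close>
  have "real n * Z / q \<le> ((real n + 1) * real k - d) * X - Y"
  proof (rule block_bound[where c = "real k - \<epsilon>"])
    show "Y \<le> (real k - \<epsilon>) * X"
      unfolding X_def Y_def by (rule adjacency_form_le[OF G reg \<epsilon>(1,2) a])
    show "- real k * X \<le> Y"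
      unfolding X_def Y_def by (rule adjacency_form_ge[OF G reg])
    show "Z \<le> (real k - \<epsilon>) * real k * X - (real k - (real k - \<epsilon>)) * Y"
      using adjacency_square_le[OF G reg \<epsilon> a] by (simp add: X_def Y_def Z_def)
    show "real n * (real k - \<epsilon>)\<^sup>2 \<le> (real n * real k + (real k - (real k - \<epsilon>)) - d) * q"
      using corona_block_psd[OF d(1)] by (simp add: q_def)
    show "real n * (real k)\<^sup>2 \<le> (real n * real k + 2 * real k - d) * q"
      using corona_block_psd[OF d(2)] by (simp add: q_def)
  qed (use q \<epsilon> in auto)
  moreover have "((real n + 1) * real k - d) * X = real n * real k * X + real k * X - d * X"
    by (simp add: algebra_simps)
  ultimately have "d * X + d * B \<le> energy G' y / 2"
    using energy by linarith
  then show ?thesis by (simp only: total distrib_left)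
qed

section \<open>From coronas with added edges to the expander family\<close>

lemma adds_edges_parcs:
  assumes "adds_edges m G G'"
  shows "parcs G \<subseteq> parcs G'"
proof
  fix e assume e: "e \<in> parcs G"
  obtain u v where uv: "e = (u, v)" by (cases e)
  have G': "simple_graph G'" using assms by (simp add: adds_edges_def)
  have "{u, v} \<in> graph_edges G" using e uv by (auto simp: graph_edges_def)
  then have "{u, v} \<in> graph_edges G'" using assms by (auto simp: adds_edges_def)
  then obtain u' v' where "{u, v} = {u', v'}" "(u', v') \<in> parcs G'"
    by (auto simp: graph_edges_def)
  \<comment> \<open>The edge may arise from the opposite arc, so symmetry is used.\<close>
  then show "e \<in> parcs G'"
    using simple_graphD(6)[OF G'] uv by (auto simp: doubleton_eq_iff)
qed

theorem theorem3p2: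
  fixes G :: "nat \<Rightarrow> 'a pair_pre_digraph"
    and H :: "'b pair_pre_digraph"
    and GH :: "nat \<Rightarrow> ('a + 'a \<times> 'b) pair_pre_digraph"
    and k n r :: nat and \<epsilon> :: real
  assumes "3 \<le> k" and "0 < \<epsilon>"
    and "expander_family k \<epsilon> G"
    and "\<And>i. \<not> complete_graph (G i)"
    and "simple_graph H" and "card (pverts H) = n"
    and "Digraph_Component.connected (with_proj H)"
    and "regular_graph r H" and "\<not> complete_graph H"
    and "even (n * k)"
    and "\<And>i. adds_edges (real n * (real n * real k - real r) * real (card (pverts (G i))) / 2)
           (G i \<star> H) (GH i)"
    and "\<And>i. regular_graph ((n + 1) * k) (GH i)"
  shows "expander_family ((n + 1) * k) (delta n k \<epsilon>) GH"
proof -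
  have G: "simple_graph (G i)" "regular_graph k (G i)" "\<epsilon> \<le> algebraic_connectivity (G i)" for i
    using assms(3) by (auto simp: expander_family_def)
  have H: "finite (pverts H)" using simple_graphD[OF assms(5)] by auto
  have n: "0 < n" using simple_graphD[OF assms(5)] assms(6) by (auto simp: card_gt_0_iff)
  have GH: "simple_graph (GH i)" "pverts (GH i) = pverts (G i \<star> H)" "parcs (G i \<star> H) \<subseteq> parcs (GH i)" for i
    using assms(11)[of i] adds_edges_parcs by (auto simp: adds_edges_def)
  have \<epsilon>_le: "\<epsilon> \<le> real k + 1"
    using algebraic_connectivity_le_degree[OF G(1,2) _ assms(2) G(3)] assms(1) by simp
  \<comment> \<open>Here \<open>k + 1 < 2 * k\<close>, as \<open>3 \<le> k\<close>.\<close>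
  have \<epsilon>_less: "\<epsilon> < 2 * real k" using \<epsilon>_le assms(1) by linarith
  have "0 < f_fun n k \<epsilon>"
  proof (rule f_fun_pos[OF assms(2)])
    have "real n * \<epsilon> < real n * (2 * real k)"
      using \<epsilon>_less n by (intro mult_strict_left_mono) auto
    then show "real n * \<epsilon> < (2 * real n + 1) * real k" by (simp add: algebra_simps)
  qed
  moreover have "0 < f_fun n k (2 * real k)"
    by (rule f_fun_pos) (use assms(1) in \<open>auto simp: algebra_simps\<close>)
  ultimately have delta_pos: "0 < delta n k \<epsilon>" by (simp add: delta_def)
  have delta_le: "delta n k \<epsilon> \<le> f_fun n k \<epsilon> / 2" "delta n k \<epsilon> \<le> f_fun n k (2 * real k) / 2"
    by (auto simp: delta_def)
  have delta_less: "delta n k \<epsilon> < real k"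
    using delta_le(2) f_fun_double_less[of n k] n assms(1) by simp
  have card_GH: "card (pverts (GH i)) = card (pverts (G i)) + card (pverts (G i)) * n" for i
    unfolding GH(2) using simple_graphD(1)[OF G(1)[of i]] H assms(6)
    by (simp add: neighbourhood_corona_def card_Plus card_cartesian_product)
  have "delta n k \<epsilon> \<le> algebraic_connectivity (GH i)" for i
  proof (rule algebraic_connectivity_ge[OF GH(1), where w = "\<lambda>p. case p of Inl _ \<Rightarrow> 1 | Inr _ \<Rightarrow> 0"])
    have "1 \<le> card (pverts (G i))"
      using simple_graphD[OF G(1)[of i]] by (simp add: Suc_le_eq card_gt_0_iff)
    \<comment> \<open>Each vertex of \<open>G i\<close> brings a nonempty copy of \<open>H\<close>,
      so the spectrum has an entry at index 1.\<close>
    then show "2 \<le> card (pverts (GH i))"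
      using mult_le_mono[of 1 "card (pverts (G i))" 1 n] n unfolding card_GH by linarith
    fix y :: "'a + 'a \<times> 'b \<Rightarrow> real"
    assume "(\<Sum>p\<in>pverts (GH i). (case p of Inl _ \<Rightarrow> 1 | Inr _ \<Rightarrow> 0) * y p) = 0"
    then have "(\<Sum>v\<in>pverts (G i). y (Inl v)) = 0"
      unfolding GH(2) using simple_graphD(1)[OF G(1)[of i]] H
      by (simp add: neighbourhood_corona_def sum.Plus)
    then show "delta n k \<epsilon> * (\<Sum>p\<in>pverts (GH i). (y p)\<^sup>2) \<le> energy (GH i) y / 2"
      using assms(1) by (intro corona_energy_bound[OF _ G(1,2) assms(2) G(3) \<epsilon>_less GH(1) H assms(6)
            GH(3) GH(2) delta_le delta_less]) auto
  qed
  moreover have "filterlim (\<lambda>i. card (pverts (GH i))) at_top sequentially"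
  proof (rule filterlim_at_top_mono)
    show "filterlim (\<lambda>i. card (pverts (G i))) at_top sequentially"
      using assms(3) by (simp add: expander_family_def)
  qed (simp add: card_GH)
  moreover have "3 \<le> (n + 1) * k" using assms(1) by simp
  ultimately show ?thesis
    using delta_pos GH(1) assms(12) by (simp add: expander_family_def)
qed

end
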